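(* Let $\theta:\mathrm{QSym}\to\mathrm{QSym}$ be the unique morphism of combinatorial Hopf algebras $(\mathrm{QSym},\gamma)\to(\mathrm{QSym},\zeta)$, let $\mathcal{G}|_{\mathrm{Mat}}$ be the restriction of $\mathcal{G}$ to $\mathrm{Mat}$, and let $\mathcal{F}:\mathrm{Mat}\to\mathrm{QSym}$ be the Billera–Jia–Reiner morphism. Then $\theta\circ\mathcal{G}|_{\mathrm{Mat}}=\mathcal{F}$.
   Context: A polymatroid is ${\bf X}=(X,\operatorname{rk})$, $X$ finite, $\operatorname{rk}$ from subsets of $X$ to $\{0,1,2,\dots\}$ with $\operatorname{rk}(\emptyset)=0$, monotone and submodular; it is a matroid if $\operatorname{rk}(\{x\})\in\{0,1\}$ for all $x$. Restriction: ${\bf X}|_A=(A,\operatorname{rk}|_A)$; contraction: ${\bf X}/A=(X\setminus A,\operatorname{rk}')$ with $\operatorname{rk}'(B)=\operatorname{rk}(A\cup B)-\operatorname{rk}(A)$; direct sum ${\bf X}\oplus{\bf Y}$ on $X\sqcup Y$ with $\operatorname{rk}(A\cup B)=\operatorname{rk}_X(A)+\operatorname{rk}_Y(B)$. $\mathrm{PolyMat}$ is the $\mathbb{Q}$-vector space with basis the isomorphism classes $[{\bf X}]$ of polymatroids, graded by $|X|$, with product $[{\bf X}][{\bf Y}]=[{\bf X}\oplus{\bf Y}]$, coproduct $\Delta[{\bf X}]=\sum_{A\subseteq X}[{\bf X}|_A]\otimes[{\bf X}/A]$, unit $[\emptyset]$ and counit $\epsilon[{\bf X}]=1$ if $X=\emptyset$,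 $0$ otherwise; it is a graded connected Hopf algebra. $\mathrm{Mat}$ is its sub-Hopf algebra spanned by matroids. $\mathrm{NSym}=\mathbb{Q}\langle p_1,p_2,\dots\rangle$ with $\Delta p_i=p_i\otimes1+1\otimes p_i$; for a sequence $\alpha=(\alpha_1,\dots,\alpha_r)$ of positive integers, $p_\alpha=p_{\alpha_1}\cdots p_{\alpha_r}$, $\ell(\alpha)=r$, $|\alpha|=\sum\alpha_i$. $\mathrm{QSym}$ is the graded dual Hopf algebra with basis $\{P_\alpha\}$ dual to $\{p_\alpha\}$; thus $P_\alpha P_\beta=\sum_\gamma P_\gamma$ over all $\binom{\ell(\alpha)+\ell(\beta)}{\ell(\alpha)}$ shuffles $\gamma$ of $\alpha,\beta$ and $\Delta P_\alpha=\sum_{\beta\gamma=\alpha}P_\beta\otimes P_\gamma$ (concatenation). It is identified with the quasi-symmetric functions via $P_\beta=\sum M_{(|\beta_1|,\dots,|\beta_r|)}/(\ell(\beta_1)!\cdots\ell(\beta_r)!)$, summing over all factorizations $\beta=\beta_1\beta_2\cdots\beta_r$ into nonempty consecutive pieces, where $M_\alpha=\sum_{i_1<\dots<i_r}x_{i_1}^{\alpha_1}\cdots x_{i_r}^{\alpha_r}$. For a sequence $a=(a_1,\dots,a_d)$ of nonnegative integers set $U_a=P_{(a_1+1,\dots,a_d+1)}$. For a polymatroid with $|X|=d$, $\mathcal{G}[{\bf X}]=\sum_{\underline X}U_{r(\underline X)}$ over all $d!$ maximal chains $\underline X:\emptyset=X_0\subset X_1\subset\cdots\subset X_d=X$ ($|X_i|=i$),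 where $r(\underline X)=(\operatorname{rk}(X_1)-\operatorname{rk}(X_0),\dots,\operatorname{rk}(X_d)-\operatorname{rk}(X_{d-1}))$; $\mathcal{G}$ is extended $\mathbb{Q}$-linearly to $\mathrm{PolyMat}$. A combinatorial Hopf algebra is a pair $(\mathcal{H},\zeta')$ with $\mathcal{H}=\bigoplus_{d\ge0}\mathcal{H}_d$ a graded Hopf algebra over $\mathbb{Q}$ with $\mathcal{H}_0=\mathbb{Q}$, each $\mathcal{H}_d$ finite-dimensional, and $\zeta':\mathcal{H}\to\mathbb{Q}$ an algebra homomorphism; a morphism $(\mathcal{H}',\zeta'')\to(\mathcal{H},\zeta')$ is a graded Hopf algebra morphism $\varphi$ with $\zeta'\circ\varphi=\zeta''$. Let $\zeta:\mathrm{QSym}\to\mathbb{Q}$ be the character with $\zeta(M_\alpha)=1$ if $\ell(\alpha)\le1$ and $0$ otherwise; $(\mathrm{QSym},\zeta)$ is a terminal object (Aguiar–Bergeron–Sottile): every combinatorial Hopf algebra has a unique morphism to it. Let $\zeta_{\mathrm{Mat}}([{\bf X}])=1$ if ${\bf X}$ is isomorphic to a direct sum of loops (one element of rank $0$) and coloops (one element of rank $1$), and $0$ otherwise; $\mathcal{F}$ is the unique morphism $(\mathrm{Mat},\zeta_{\mathrm{Mat}})\to(\mathrm{QSym},\zeta)$. Let $\gamma:\mathrm{QSym}\to\mathbb{Q}$ be the linear map with $\gamma(P_\alpha)=0$ if $\alpha$ is not weakly increasing, and, if $\alpha=(a_1^{k_1},\dots,a_s^{k_s})$ with $a_1<\dots<a_s$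 (meaning $a_j$ repeated $k_j$ times), $\gamma(P_\alpha)=1/(k_1!\cdots k_s!)$ (in particular $\gamma(P_{()})=1$); $\gamma$ is an algebra homomorphism, so $(\mathrm{QSym},\gamma)$ is a combinatorial Hopf algebra.
   Formalization: As stated the gradings clash (θ(G[coloop])=M_(2), but F[coloop]=M_(1)); the identity is proved for two corrected gradings: the source QSym of θ graded by ℓ(α) with F as given, and Mat graded by |X|+rk(X) with θ as given. *)

theory Defs
  imports Complex_Main "HOL-Library.Poly_Mapping"
begin

section \<open>Rational vector spaces with a basis\<close>

text \<open>\<open>'b vec\<close> is the free rational vector space on \<open>'b\<close>; the tensor product of the spaces on
  \<open>'a\<close> and \<open>'b\<close> is the space on \<open>'a \<times> 'b\<close>.\<close>

type_synonym 'b vec = "'b \<Rightarrow>\<^sub>0 rat"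

definition scale :: "rat \<Rightarrow> 'b vec \<Rightarrow> 'b vec" where
  "scale c x = Poly_Mapping.map ((*) c) x"

abbreviation bvec :: "'b \<Rightarrow> 'b vec" where
  "bvec b \<equiv> Poly_Mapping.single b 1"

definition lin_ext :: "('a \<Rightarrow> 'b vec) \<Rightarrow> 'a vec \<Rightarrow> 'b vec" where
  "lin_ext f x = (\<Sum>a\<in>Poly_Mapping.keys x. scale (Poly_Mapping.lookup x a) (f a))"

definition lin_form :: "('a \<Rightarrow> rat) \<Rightarrow> 'a vec \<Rightarrow> rat" where
  "lin_form f x = (\<Sum>a\<in>Poly_Mapping.keys x. Poly_Mapping.lookup x a * f a)"

definition tensor :: "'a vec \<Rightarrow> 'b vec \<Rightarrow> ('a \<times> 'b) vec" where
  "tensor x y = (\<Sum>a\<in>Poly_Mapping.keys x. \<Sum>b\<in>Poly_Mapping.keys y.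
     Poly_Mapping.single (a, b) (Poly_Mapping.lookup x a * Poly_Mapping.lookup y b))"

definition tensor_map :: "('a vec \<Rightarrow> 'b vec) \<Rightarrow> ('a \<times> 'a) vec \<Rightarrow> ('b \<times> 'b) vec" where
  "tensor_map \<phi> = lin_ext (\<lambda>(a, b). tensor (\<phi> (bvec a)) (\<phi> (bvec b)))"


section \<open>Graded Hopf algebras and morphisms of combinatorial Hopf algebras\<close>

text \<open>The underlying space is spanned by \<open>basis\<close>, which consists of homogeneous elements; the
  structure maps are given by their values on basis elements.\<close>

record 'b graded_hopf =
  basis :: "'b set"
  deg :: "'b \<Rightarrow> nat"
  bmult :: "'b \<Rightarrow> 'b \<Rightarrow> 'b vec"
  hunit :: "'b vec"
  bcomult :: "'b \<Rightarrow> ('b \<times> 'b) vec"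
  bcounit :: "'b \<Rightarrow> rat"

definition hspace :: "'b graded_hopf \<Rightarrow> 'b vec set" where
  "hspace H = {x. Poly_Mapping.keys x \<subseteq> basis H}"

definition hcomponent :: "'b graded_hopf \<Rightarrow> nat \<Rightarrow> 'b vec set" where
  "hcomponent H d = {x \<in> hspace H. \<forall>b\<in>Poly_Mapping.keys x. deg H b = d}"

definition hmult :: "'b graded_hopf \<Rightarrow> 'b vec \<Rightarrow> 'b vec \<Rightarrow> 'b vec" where
  "hmult H x y = lin_ext (\<lambda>(a, b). bmult H a b) (tensor x y)"

definition hcomult :: "'b graded_hopf \<Rightarrow> 'b vec \<Rightarrow> ('b \<times> 'b) vec" where
  "hcomult H = lin_ext (bcomult H)"

definition hcounit :: "'b graded_hopf \<Rightarrow> 'b vec \<Rightarrow> rat" where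
  "hcounit H = lin_form (bcounit H)"

text \<open>Compatibility with antipodes is automatic for a morphism of bialgebras between Hopf
  algebras.\<close>

definition hopf_morphism ::
  "'a graded_hopf \<Rightarrow> 'b graded_hopf \<Rightarrow> ('a vec \<Rightarrow> 'b vec) \<Rightarrow> bool" where
  "hopf_morphism H' H \<phi> \<longleftrightarrow>
     (\<forall>x\<in>hspace H'. \<phi> x \<in> hspace H) \<and>
     (\<forall>x\<in>hspace H'. \<forall>y\<in>hspace H'. \<phi> (x + y) = \<phi> x + \<phi> y) \<and>
     (\<forall>c. \<forall>x\<in>hspace H'. \<phi> (scale c x) = scale c (\<phi> x)) \<and>
     \<phi> (hunit H') = hunit H \<and>
     (\<forall>x\<in>hspace H'. \<forall>y\<in>hspace H'. \<phi> (hmult H' x y) = hmult H (\<phi> x) (\<phi> y)) \<and>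
     (\<forall>x\<in>hspace H'. hcounit H (\<phi> x) = hcounit H' x) \<and>
     (\<forall>x\<in>hspace H'. hcomult H (\<phi> x) = tensor_map \<phi> (hcomult H' x))"

definition cha_morphism ::
  "'a graded_hopf \<Rightarrow> ('a vec \<Rightarrow> rat) \<Rightarrow> 'b graded_hopf \<Rightarrow> ('b vec \<Rightarrow> rat)
     \<Rightarrow> ('a vec \<Rightarrow> 'b vec) \<Rightarrow> bool" where
  "cha_morphism H' \<zeta>' H \<zeta> \<phi> \<longleftrightarrow>
     hopf_morphism H' H \<phi> \<and>
     (\<forall>d. \<forall>x\<in>hcomponent H' d. \<phi> x \<in> hcomponent H d) \<and>
     (\<forall>x\<in>hspace H'. \<zeta> (\<phi> x) = \<zeta>' x)"


section \<open>Quasi-symmetric functions\<close>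

text \<open>The basis vector \<open>bvec \<alpha>\<close> is \<open>P\<^sub>\<alpha>\<close>.\<close>

text \<open>All shuffles of two words, listed with multiplicity; the library function \<open>shuffles\<close>
  only gives the set of shuffles.\<close>

fun shuffle_list :: "'a list \<Rightarrow> 'a list \<Rightarrow> 'a list list" where
  "shuffle_list [] ys = [ys]"
| "shuffle_list (x # xs) [] = [x # xs]"
| "shuffle_list (x # xs) (y # ys) =
     map ((#) x) (shuffle_list xs (y # ys)) @ map ((#) y) (shuffle_list (x # xs) ys)"

definition QSym :: "nat list graded_hopf" where
  "QSym = \<lparr>
     basis = {\<alpha>. \<forall>i\<in>set \<alpha>. 0 < i},
     deg = sum_list,
     bmult = (\<lambda>\<alpha> \<beta>. \<Sum>\<gamma>\<leftarrow>shuffle_list \<alpha> \<beta>. bvec \<gamma>),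
     hunit = bvec [],
     bcomult = (\<lambda>\<alpha>. \<Sum>k\<le>length \<alpha>. bvec (take k \<alpha>, drop k \<alpha>)),
     bcounit = (\<lambda>\<alpha>. if \<alpha> = [] then 1 else 0)\<rparr>"

definition factorizations :: "'a list \<Rightarrow> 'a list list set" where
  "factorizations \<beta> = {bs. concat bs = \<beta> \<and> [] \<notin> set bs}"

text \<open>The coordinates of a quasi-symmetric function, given in the basis \<open>P\<close>, with respect to the
  monomial basis \<open>M\<close>.\<close>

definition M_coords :: "nat list vec \<Rightarrow> nat list vec" where
  "M_coords = lin_ext (\<lambda>\<beta>. \<Sum>bs\<in>factorizations \<beta>.
     Poly_Mapping.single (map sum_list bs) (1 / (\<Prod>b\<leftarrow>bs. fact (length b))))"

definition zeta :: "nat list vec \<Rightarrow> rat" where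
  "zeta x = lin_form (\<lambda>\<alpha>. if length \<alpha> \<le> 1 then 1 else 0) (M_coords x)"

definition gamma :: "nat list vec \<Rightarrow> rat" where
  "gamma = lin_form (\<lambda>\<alpha>. if sorted \<alpha> then 1 / (\<Prod>a\<in>set \<alpha>. fact (count_list \<alpha> a)) else 0)"

definition U :: "nat list \<Rightarrow> nat list vec" where
  "U a = bvec (map Suc a)"


section \<open>Polymatroids\<close>

text \<open>A polymatroid is a pair of a ground set and a rank function, of which only the values on
  subsets of the ground set matter.\<close>

type_synonym 'a pmat = "'a set \<times> ('a set \<Rightarrow> nat)"

abbreviation ground :: "'a pmat \<Rightarrow> 'a set" where "ground \<equiv> fst"
abbreviation rk :: "'a pmat \<Rightarrow> 'a set \<Rightarrow> nat" where "rk \<equiv> snd"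

definition polymatroid :: "'a pmat \<Rightarrow> bool" where
  "polymatroid X \<longleftrightarrow>
     finite (ground X) \<and>
     rk X {} = 0 \<and>
     (\<forall>A B. A \<subseteq> B \<and> B \<subseteq> ground X \<longrightarrow> rk X A \<le> rk X B) \<and>
     (\<forall>A B. A \<subseteq> ground X \<and> B \<subseteq> ground X \<longrightarrow>
        rk X (A \<union> B) + rk X (A \<inter> B) \<le> rk X A + rk X B)"

definition matroid :: "'a pmat \<Rightarrow> bool" where
  "matroid X \<longleftrightarrow> polymatroid X \<and> (\<forall>x\<in>ground X. rk X {x} \<in> {0, 1})"

definition pm_restrict :: "'a pmat \<Rightarrow> 'a set \<Rightarrow> 'a pmat" where
  "pm_restrict X A = (A, rk X)"

definition pm_contract :: "'a pmat \<Rightarrow> 'a set \<Rightarrow> 'a pmat" where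
  "pm_contract X A = (ground X - A, \<lambda>B. rk X (A \<union> B) - rk X A)"

definition pm_sum :: "'a pmat \<Rightarrow> 'b pmat \<Rightarrow> ('a + 'b) pmat" where
  "pm_sum X Y = (ground X <+> ground Y, \<lambda>C. rk X (Inl -` C) + rk Y (Inr -` C))"

definition pm_Sum :: "'i set \<Rightarrow> ('i \<Rightarrow> 'a pmat) \<Rightarrow> ('i \<times> 'a) pmat" where
  "pm_Sum I X = (SIGMA i:I. ground (X i), \<lambda>C. \<Sum>i\<in>I. rk (X i) (Pair i -` C))"

definition pm_iso :: "'a pmat \<Rightarrow> 'b pmat \<Rightarrow> bool" where
  "pm_iso X Y \<longleftrightarrow>
     (\<exists>f. bij_betw f (ground X) (ground Y) \<and> (\<forall>A\<subseteq>ground X. rk Y (f ` A) = rk X A))"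

definition loop :: "unit pmat" where "loop = ({()}, \<lambda>A. 0)"

definition coloop :: "unit pmat" where "coloop = ({()}, card)"

definition sum_of_loops_coloops :: "'a pmat \<Rightarrow> bool" where
  "sum_of_loops_coloops X \<longleftrightarrow>
     (\<exists>(I :: nat set) Y. finite I \<and> (\<forall>i\<in>I. Y i \<in> {loop, coloop}) \<and> pm_iso X (pm_Sum I Y))"

text \<open>Every polymatroid has an isomorphic copy on a set of natural numbers, so its isomorphism
  class is represented by the set of all these copies.\<close>

type_synonym pm_class = "nat pmat set"

definition iso_class :: "'a pmat \<Rightarrow> pm_class" where
  "iso_class X = {Y. polymatroid Y \<and> pm_iso X Y}"

definition pm_rep :: "pm_class \<Rightarrow> nat pmat" where
  "pm_rep c = (SOME X. X \<in> c)"

definition class_size :: "pm_class \<Rightarrow> nat" where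
  "class_size c = card (ground (pm_rep c))"

definition class_rank :: "pm_class \<Rightarrow> nat" where
  "class_rank c = rk (pm_rep c) (ground (pm_rep c))"

definition PolyMat :: "pm_class graded_hopf" where
  "PolyMat = \<lparr>
     basis = {iso_class X | X :: nat pmat. polymatroid X},
     deg = class_size,
     bmult = (\<lambda>c d. bvec (iso_class (pm_sum (pm_rep c) (pm_rep d)))),
     hunit = bvec (iso_class ({} :: nat set, \<lambda>A. 0)),
     bcomult = (\<lambda>c. let X = pm_rep c in
        \<Sum>A\<in>Pow (ground X). bvec (iso_class (pm_restrict X A), iso_class (pm_contract X A))),
     bcounit = (\<lambda>c. if ground (pm_rep c) = {} then 1 else 0)\<rparr>"

definition Mat :: "pm_class graded_hopf" where
  "Mat = PolyMat\<lparr>basis := {iso_class X | X :: nat pmat. matroid X}\<rparr>"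

definition zeta_Mat :: "pm_class vec \<Rightarrow> rat" where
  "zeta_Mat = lin_form (\<lambda>c. if sum_of_loops_coloops (pm_rep c) then 1 else 0)"


section \<open>The invariant \<open>\<G>\<close>\<close>

definition maximal_chains :: "'a set \<Rightarrow> 'a set list set" where
  "maximal_chains X = {C. length C = card X + 1 \<and> C ! 0 = {} \<and> C ! card X = X \<and>
     (\<forall>i\<le>card X. card (C ! i) = i) \<and> (\<forall>i<card X. C ! i \<subset> C ! (i + 1))}"

definition rank_seq :: "'a pmat \<Rightarrow> 'a set list \<Rightarrow> nat list" where
  "rank_seq X C = map (\<lambda>i. rk X (C ! (i + 1)) - rk X (C ! i)) [0..<card (ground X)]"

definition G_pm :: "'a pmat \<Rightarrow> nat list vec" where
  "G_pm X = (\<Sum>C\<in>maximal_chains (ground X). U (rank_seq X C))"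

definition G :: "pm_class vec \<Rightarrow> nat list vec" where
  "G = lin_ext (\<lambda>c. G_pm (pm_rep c))"

text \<open>\<open>G\<close> does not preserve the degrees of \<open>PolyMat\<close> and \<open>QSym\<close>: the image of the class of \<open>X\<close> is a
  combination of words of length \<open>|X|\<close> and sum \<open>|X| + rk X\<close>. Hence \<open>G\<close> is graded if either the degree
  of \<open>P\<^sub>\<alpha>\<close> is taken to be the length of \<open>\<alpha>\<close>, or the degree of \<open>X\<close> is taken to be \<open>|X| + rk X\<close>.\<close>

end

theory Submission
  imports Defs "HOL-Combinatorics.Multiset_Permutations"
begin

text \<open>
  Write \<open>\<G>\<close> as a sum over permutations of the ground set. Cutting a permutation in two shows that
  \<open>\<G>\<close> is a morphism of coalgebras, and on matroids \<open>\<gamma> \<circ> \<G> = \<zeta>\<^sub>M\<^sub>a\<^sub>t\<close>: the rank word of a permutation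
  is sorted only if the non-loops are independent, and then exactly when the loops come first.
  Now induct on the size of the matroid \<open>X\<close>. By the induction hypothesis, the difference \<open>\<delta>\<close> of
  \<open>\<theta> (\<G> [X])\<close> and \<open>\<F> [X]\<close> has vanishing reduced coproduct. The coproduct of \<open>QSym\<close> being deconcatenation
  of words and \<open>\<delta>\<close> being homogeneous of some degree \<open>d > 0\<close>, it is a multiple of \<open>P\<^sub>(\<^sub>d\<^sub>)\<close>, which is
  detected by \<open>\<zeta>\<close>; but \<open>\<zeta> \<delta> = 0\<close>.
\<close>

section \<open>Linear algebra in free rational vector spaces\<close>

lemma lookup_scale [simp]: "Poly_Mapping.lookup (scale c x) k = c * Poly_Mapping.lookup x k"
  by (simp add: scale_def Poly_Mapping.map.rep_eq when_def)

lemma scale_0_left [simp]: "scale 0 x = 0"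
  and scale_0_right [simp]: "scale c 0 = 0"
  and scale_1 [simp]: "scale 1 x = x"
  and scale_scale: "scale c (scale d x) = scale (c * d) x"
  and scale_add_left: "scale (c + d) x = scale c x + scale d x"
  and scale_add_right: "scale c (x + y) = scale c x + scale c y"
  by (simp_all add: poly_mapping_eq_iff fun_eq_iff lookup_add algebra_simps)

lemma keys_scale_subset: "Poly_Mapping.keys (scale c x) \<subseteq> Poly_Mapping.keys x"
  by (auto simp: in_keys_iff)

lemma scale_sum: "scale c (\<Sum>i\<in>S. g i) = (\<Sum>i\<in>S. scale c (g i))"
  by (induction S rule: infinite_finite_induct) (simp_all add: scale_add_right)

text \<open>Cancellation can make the keys of a sum smaller than the union of the keys. Summing over
  a common finite superset makes additivity provable termwise.\<close>

lemma lin_ext_superset: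
  assumes "finite S" "Poly_Mapping.keys x \<subseteq> S"
  shows "lin_ext f x = (\<Sum>a\<in>S. scale (Poly_Mapping.lookup x a) (f a))"
  unfolding lin_ext_def by (rule sum.mono_neutral_left) (use assms in \<open>auto simp: in_keys_iff\<close>)

lemma lin_ext_0 [simp]: "lin_ext f 0 = 0"
  by (simp add: lin_ext_def)

lemma lin_ext_single [simp]: "lin_ext f (Poly_Mapping.single a c) = scale c (f a)"
  by (subst lin_ext_superset[of "{a}"]) auto

lemma lin_ext_add: "lin_ext f (x + y) = lin_ext f x + lin_ext f y"
proof -
  let ?S = "Poly_Mapping.keys x \<union> Poly_Mapping.keys y"
  have "Poly_Mapping.keys (x + y) \<subseteq> ?S" by (rule Poly_Mapping.keys_add)
  then show ?thesis
    by (simp add: lin_ext_superset[of ?S] lookup_add scale_add_left sum.distrib)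
qed

lemma lin_ext_scale: "lin_ext f (scale c x) = scale c (lin_ext f x)"
  by (simp add: lin_ext_superset[of "Poly_Mapping.keys x"] keys_scale_subset scale_sum scale_scale)

lemma lin_ext_sum: "lin_ext f (\<Sum>i\<in>S. g i) = (\<Sum>i\<in>S. lin_ext f (g i))"
  by (induction S rule: infinite_finite_induct) (simp_all add: lin_ext_add)

lemma lookup_lin_ext:
  "Poly_Mapping.lookup (lin_ext f x) k =
     (\<Sum>a\<in>Poly_Mapping.keys x. Poly_Mapping.lookup x a * Poly_Mapping.lookup (f a) k)"
  by (simp add: lin_ext_def lookup_sum)

lemma lin_form_superset:
  assumes "finite S" "Poly_Mapping.keys x \<subseteq> S"
  shows "lin_form f x = (\<Sum>a\<in>S. Poly_Mapping.lookup x a * f a)"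
  unfolding lin_form_def by (rule sum.mono_neutral_left) (use assms in \<open>auto simp: in_keys_iff\<close>)

lemma lin_form_0 [simp]: "lin_form f 0 = 0"
  by (simp add: lin_form_def)

lemma lin_form_single [simp]: "lin_form f (Poly_Mapping.single a c) = c * f a"
  by (subst lin_form_superset[of "{a}"]) auto

lemma lin_form_add: "lin_form f (x + y) = lin_form f x + lin_form f y"
proof -
  let ?S = "Poly_Mapping.keys x \<union> Poly_Mapping.keys y"
  have "Poly_Mapping.keys (x + y) \<subseteq> ?S" by (rule Poly_Mapping.keys_add)
  then show ?thesis
    by (simp add: lin_form_superset[of ?S] lookup_add distrib_right sum.distrib)
qed

lemma lin_form_sum: "lin_form f (\<Sum>i\<in>S. g i) = (\<Sum>i\<in>S. lin_form f (g i))"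
  by (induction S rule: infinite_finite_induct) (simp_all add: lin_form_add)

lemma lookup_tensor [simp]:
  "Poly_Mapping.lookup (tensor x y) (a, b) = Poly_Mapping.lookup x a * Poly_Mapping.lookup y b"
proof -
  have "Poly_Mapping.lookup (tensor x y) (a, b) =
      (\<Sum>a'\<in>Poly_Mapping.keys x. \<Sum>b'\<in>Poly_Mapping.keys y.
        if b' = b then (if a' = a then Poly_Mapping.lookup x a * Poly_Mapping.lookup y b else 0) else 0)"
    unfolding tensor_def lookup_sum
    by (intro sum.cong refl) (auto simp: lookup_single when_def)
  also have "\<dots> = Poly_Mapping.lookup x a * Poly_Mapping.lookup y b"
    by (cases "Poly_Mapping.lookup y b = 0") (auto simp: in_keys_iff)
  finally show ?thesis .
qed

lemma tensor_map_bvec [simp]: "tensor_map \<phi> (bvec (a, b)) = tensor (\<phi> (bvec a)) (\<phi> (bvec b))"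
  by (simp add: tensor_map_def)

lemma tensor_map_sum: "tensor_map \<phi> (\<Sum>i\<in>S. g i) = (\<Sum>i\<in>S. tensor_map \<phi> (g i))"
  by (simp add: tensor_map_def lin_ext_sum)

lemma hspace_0 [simp]: "0 \<in> hspace H"
  by (simp add: hspace_def)

lemma hspace_bvec_iff [simp]: "bvec b \<in> hspace H \<longleftrightarrow> b \<in> basis H"
  by (simp add: hspace_def)

lemma hspace_add: "x \<in> hspace H \<Longrightarrow> y \<in> hspace H \<Longrightarrow> x + y \<in> hspace H"
  using Poly_Mapping.keys_add[of x y] by (auto simp: hspace_def)

lemma hspace_scale: "x \<in> hspace H \<Longrightarrow> scale c x \<in> hspace H"
  using keys_scale_subset[of c x] by (auto simp: hspace_def)

lemma hspace_sum: "(\<And>i. i \<in> S \<Longrightarrow> g i \<in> hspace H) \<Longrightarrow> (\<Sum>i\<in>S. g i) \<in> hspace H"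
  by (induction S rule: infinite_finite_induct) (auto intro: hspace_add)

lemma hspace_lin_ext: "(\<And>a. a \<in> Poly_Mapping.keys x \<Longrightarrow> f a \<in> hspace H) \<Longrightarrow> lin_ext f x \<in> hspace H"
  by (auto simp: lin_ext_def intro!: hspace_sum hspace_scale)

lemma lin_ext_bvec: "lin_ext bvec x = x"
  by (rule poly_mapping_eqI)
     (auto simp: lookup_lin_ext lookup_single when_def in_keys_iff if_distrib cong: if_cong)

text \<open>A morphism is constrained only on \<open>hspace\<close> and is an arbitrary function
  elsewhere, so linearity may be used only along elements of \<open>hspace\<close>. Such an element
  expands there because its keys are basis elements.\<close>

lemma linear_on_hspace:
  assumes add: "\<And>x y. x \<in> hspace H \<Longrightarrow> y \<in> hspace H \<Longrightarrow> \<phi> (x + y) = \<phi> x + \<phi> y"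
    and scl: "\<And>c x. x \<in> hspace H \<Longrightarrow> \<phi> (scale c x) = scale c (\<phi> x)"
  shows linear_on_hspace_sum:
      "(\<And>i. i \<in> S \<Longrightarrow> g i \<in> hspace H) \<Longrightarrow> \<phi> (\<Sum>i\<in>S. g i) = (\<Sum>i\<in>S. \<phi> (g i))"
    and linear_on_hspace_lin_ext: "x \<in> hspace H \<Longrightarrow> \<phi> x = lin_ext (\<lambda>b. \<phi> (bvec b)) x"
proof -
  have zero: "\<phi> 0 = 0" using scl[of 0 0] by simp
  show sum: "\<phi> (\<Sum>i\<in>S. g i) = (\<Sum>i\<in>S. \<phi> (g i))" if "\<And>i. i \<in> S \<Longrightarrow> g i \<in> hspace H" for S g
    using that
    by (induction S rule: infinite_finite_induct) (auto simp: zero add hspace_sum)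
  show "\<phi> x = lin_ext (\<lambda>b. \<phi> (bvec b)) x" if "x \<in> hspace H"
  proof -
    have b: "b \<in> basis H" if "b \<in> Poly_Mapping.keys x" for b
      using that \<open>x \<in> hspace H\<close> by (auto simp: hspace_def)
    have "\<phi> x = \<phi> (lin_ext bvec x)" by (simp add: lin_ext_bvec)
    also have "\<dots> = lin_ext (\<lambda>b. \<phi> (bvec b)) x"
      unfolding lin_ext_def using b by (subst sum) (auto intro!: hspace_scale simp: scl)
    finally show ?thesis .
  qed
qed

section \<open>Deconcatenation of words and the character \<open>zeta\<close>\<close>

lemma hcomult_QSym_bvec:
  "hcomult QSym (bvec \<alpha>) = (\<Sum>k\<le>length \<alpha>. bvec (take k \<alpha>, drop k \<alpha>))"
  by (simp add: hcomult_def QSym_def)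

text \<open>A pair of words comes from exactly one word, cut at exactly one place. Hence the
  coproduct reveals every coefficient at a word that can be cut into two nonempty pieces.\<close>

lemma lookup_hcomult_QSym:
  "Poly_Mapping.lookup (hcomult QSym x) (u, v) = Poly_Mapping.lookup x (u @ v)"
proof -
  have eq: "Poly_Mapping.lookup (bcomult QSym \<alpha>) (u, v) = (if \<alpha> = u @ v then 1 else 0)" for \<alpha>
  proof -
    have "Poly_Mapping.lookup (bcomult QSym \<alpha>) (u, v) =
        (\<Sum>k\<le>length \<alpha>. if take k \<alpha> = u \<and> drop k \<alpha> = v then 1 else 0)"
      by (simp add: QSym_def lookup_sum lookup_single when_def)
    also have "\<dots> = (\<Sum>k\<le>length \<alpha>. if k = length u then (if \<alpha> = u @ v then 1 else 0) else 0)"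
    proof (intro sum.cong refl)
      fix k assume "k \<in> {..length \<alpha>}"
      then have "take k \<alpha> = u \<and> drop k \<alpha> = v \<longleftrightarrow> k = length u \<and> \<alpha> = u @ v"
        by (auto simp: append_eq_conv_conj)
      then show "(if take k \<alpha> = u \<and> drop k \<alpha> = v then 1 else 0 :: rat) =
          (if k = length u then (if \<alpha> = u @ v then 1 else 0) else 0)" by simp
    qed
    also have "\<dots> = (if \<alpha> = u @ v then 1 else 0)" by auto
    finally show ?thesis .
  qed
  show ?thesis
    by (auto simp: hcomult_def lookup_lin_ext eq in_keys_iff if_distrib cong: if_cong)
qed

lemma zeta_add: "zeta (x + y) = zeta x + zeta y"
  by (simp add: zeta_def M_coords_def lin_ext_add lin_form_add)

lemma factorizations_singleton: "factorizations [a] = {[[a]]}"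
proof -
  have "bs = [[a]]" if "concat bs = [a]" "[] \<notin> set bs" for bs
    using that by (cases bs) (auto simp: append_eq_Cons_conv concat_eq_Nil_conv, metis list.set_intros(1) neq_Nil_conv)
  then show ?thesis by (auto simp: factorizations_def)
qed

text \<open>A one-letter word has a single factorization, of weight 1/1!, so here the bases
  \<open>P\<close> and \<open>M\<close> agree and \<open>zeta\<close> reads off the
  coefficient.\<close>

lemma zeta_single_singleton: "zeta (Poly_Mapping.single [d] c) = c"
  by (simp add: zeta_def M_coords_def factorizations_singleton scale_def)

section \<open>Rank words and maximal chains\<close>

text \<open>The second argument holds the elements already passed. A nonempty start describes the
  tail of a permutation, which a contraction reads from the empty set.\<close>

fun rank_word :: "('a set \<Rightarrow> nat) \<Rightarrow> 'a set \<Rightarrow> 'a list \<Rightarrow> nat list" where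
  "rank_word r A [] = []"
| "rank_word r A (x # xs) = (r (insert x A) - r A) # rank_word r (insert x A) xs"

lemma length_rank_word [simp]: "length (rank_word r A xs) = length xs"
  by (induction xs arbitrary: A) auto

lemma rank_word_append:
  "rank_word r A (xs @ ys) = rank_word r A xs @ rank_word r (A \<union> set xs) ys"
  by (induction xs arbitrary: A) auto

lemma rank_word_conv_map:
  "rank_word r A xs =
     map (\<lambda>i. r (A \<union> set (take (i + 1) xs)) - r (A \<union> set (take i xs))) [0..<length xs]"
  by (induction xs arbitrary: A) (simp_all add: map_upt_Suc del: upt_Suc)

lemma rank_word_cong:
  assumes "\<And>B. B \<subseteq> S \<Longrightarrow> r B = r' B" "A \<union> set xs \<subseteq> S"
  shows "rank_word r A xs = rank_word r' A xs"
  using assms by (induction xs arbitrary: A) auto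

lemma rank_word_image:
  "rank_word r (f ` A) (map f xs) = rank_word (\<lambda>B. r (f ` B)) A xs"
  by (induction xs arbitrary: A) (simp_all flip: image_insert)

text \<open>Subtraction is truncated on the naturals; the lower bound on
  \<open>r (A \<union> C)\<close> makes the two subtractions of \<open>r A\<close> cancel.\<close>

lemma rank_word_contract:
  assumes "\<And>C. C \<subseteq> B \<union> set xs \<Longrightarrow> r A \<le> r (A \<union> C)"
  shows "rank_word (\<lambda>B. r (A \<union> B) - r A) B xs = rank_word r (A \<union> B) xs"
  using assms
proof (induction xs arbitrary: B)
  case (Cons x xs)
  have "r A \<le> r (A \<union> B)" using Cons.prems by auto
  then show ?case using Cons.IH[of "insert x B"] Cons.prems by auto
qed simp

text \<open>The differences telescope; monotonicity keeps them from being truncated.\<close>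

lemma sum_list_rank_word:
  assumes "\<And>B C. B \<subseteq> C \<Longrightarrow> C \<subseteq> S \<Longrightarrow> r B \<le> r C" "A \<union> set xs \<subseteq> S"
  shows "r A + sum_list (rank_word r A xs) = r (A \<union> set xs)"
  using assms(2)
proof (induction xs arbitrary: A)
  case (Cons x xs)
  have "r A \<le> r (insert x A)" using Cons.prems by (intro assms(1)) auto
  then show ?case using Cons.IH[of "insert x A"] Cons.prems by auto
qed simp

lemma set_take_Suc_diff:
  "distinct xs \<Longrightarrow> i < length xs \<Longrightarrow> set (take (Suc i) xs) - set (take i xs) = {xs ! i}"
  by (auto simp: take_Suc_conv_app_nth in_set_conv_nth distinct_conv_nth)

text \<open>A maximal chain adds one element at a time, so it consists of the sets of prefixes of a
  unique permutation.\<close>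

lemma G_pm_conv_permutations:
  assumes fin: "finite (ground X)"
  shows "G_pm X = (\<Sum>xs\<in>permutations_of_set (ground X). U (rank_word (rk X) {} xs))"
proof -
  let ?n = "card (ground X)"
  \<comment> \<open>\<open>p\<close> lists the elements in the order in which a chain adds them, and
    \<open>c\<close> forms the sets of prefixes. They are inverse to each other between chains and
    permutations.\<close>
  define p where "p C = map (\<lambda>i. the_elem (C ! (i + 1) - C ! i)) [0..<?n]" for C :: "'a set list"
  define c where "c xs = map (\<lambda>i. set (take i xs)) [0..<?n + 1]" for xs :: "'a list"
  have take_p: "set (take i (p C)) = C ! i" if C: "C \<in> maximal_chains (ground X)" and "i \<le> ?n" for C i
    using \<open>i \<le> ?n\<close>
  proof (induction i)
    case 0
    then show ?case using C by (simp add: maximal_chains_def)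
  next
    case (Suc i)
    have sub: "C ! i \<subset> C ! (i + 1)" and cc: "card (C ! i) = i" "card (C ! (i + 1)) = i + 1"
      using C Suc.prems by (auto simp: maximal_chains_def)
    \<comment> \<open>Infinite sets have \<open>card\<close> 0, so the positive cardinality of the
      next set makes it finite, and with it its subset \<open>C ! i\<close>.\<close>
    have "finite (C ! i)"
      using sub cc by (metis add_is_0 card.infinite finite_subset less_imp_le one_neq_zero)
    then have "card (C ! (i + 1) - C ! i) = 1"
      using sub cc by (subst card_Diff_subset) auto
    then obtain y where y: "C ! (i + 1) - C ! i = {y}" by (rule card_1_singletonE)
    have "p C ! i = y" using Suc.prems y by (simp add: p_def)
    then have "set (take (Suc i) (p C)) = insert y (C ! i)"
      using Suc by (simp add: take_Suc_conv_app_nth p_def)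
    also have "\<dots> = C ! Suc i" using y sub by auto
    finally show ?case .
  qed
  have perm: "length xs = ?n" "distinct xs" "set xs = ground X"
    if "xs \<in> permutations_of_set (ground X)" for xs
    using that by (auto simp: permutations_of_set_def distinct_card[symmetric])
  have nth_c: "c xs ! i = set (take i xs)" if "i \<le> ?n" for xs i
    using that unfolding c_def by (simp add: nth_append del: upt_Suc)
  show ?thesis
    unfolding G_pm_def
  proof (rule sum.reindex_bij_witness[where i = c and j = p])
    fix C assume C: "C \<in> maximal_chains (ground X)"
    have len: "length C = ?n + 1" using C by (simp add: maximal_chains_def)
    have lc: "length (c (p C)) = ?n + 1" by (simp add: c_def)
    show "c (p C) = C"
      by (rule nth_equalityI) (simp_all add: lc len nth_c take_p[OF C])
    have lp: "length (p C) = ?n" by (simp add: p_def)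
    have "set (p C) = ground X"
      using take_p[OF C, of ?n] C lp by (simp add: maximal_chains_def)
    then show "p C \<in> permutations_of_set (ground X)"
      using lp by (simp add: permutations_of_set_def card_distinct)
    show "U (rank_word (rk X) {} (p C)) = U (rank_seq X C)"
      unfolding rank_word_conv_map rank_seq_def lp
      by (intro arg_cong[of _ _ U] map_cong refl) (simp add: take_p[OF C])
  next
    fix xs assume xs: "xs \<in> permutations_of_set (ground X)"
    note p = perm[OF xs]
    show "p (c xs) = xs"
      by (rule nth_equalityI) (use p in \<open>simp_all add: p_def nth_c set_take_Suc_diff\<close>)
    show "c xs \<in> maximal_chains (ground X)"
      unfolding maximal_chains_def
    proof (intro CollectI conjI allI impI)
      show "length (c xs) = ?n + 1" by (simp add: c_def)
      show "c xs ! 0 = {}" "c xs ! ?n = ground X" using p by (simp_all add: nth_c)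
      show "card (c xs ! i) = i" if "i \<le> ?n" for i
        using that p by (simp add: nth_c distinct_card)
      show "c xs ! i \<subset> c xs ! (i + 1)" if "i < ?n" for i
        using that p set_take_Suc_diff[of xs i] set_take_subset_set_take[of i "Suc i" xs]
        by (auto simp: nth_c)
    qed
  qed
qed

section \<open>Minors of matroids and invariance under isomorphism\<close>

lemma polymatroid_mono:
  "polymatroid X \<Longrightarrow> A \<subseteq> B \<Longrightarrow> B \<subseteq> ground X \<Longrightarrow> rk X A \<le> rk X B"
  by (simp add: polymatroid_def)

lemma polymatroid_submodular:
  "polymatroid X \<Longrightarrow> A \<subseteq> ground X \<Longrightarrow> B \<subseteq> ground X \<Longrightarrow>
    rk X (A \<union> B) + rk X (A \<inter> B) \<le> rk X A + rk X B"
  by (simp add: polymatroid_def)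

lemma matroid_restrict:
  assumes "matroid X" "A \<subseteq> ground X"
  shows "matroid (pm_restrict X A)"
proof -
  have pm: "polymatroid X" using assms by (simp add: matroid_def)
  have "finite A" using pm assms(2) by (metis finite_subset polymatroid_def)
  moreover have "rk X (B \<union> C) + rk X (B \<inter> C) \<le> rk X B + rk X C" if "B \<subseteq> A" "C \<subseteq> A" for B C
    using that assms(2) by (intro polymatroid_submodular[OF pm]) auto
  moreover have "rk X B \<le> rk X C" if "B \<subseteq> C" "C \<subseteq> A" for B C
    using that assms(2) by (intro polymatroid_mono[OF pm]) auto
  moreover have "rk X {} = 0" using pm by (simp add: polymatroid_def)
  moreover have "\<forall>x\<in>A. rk X {x} \<in> {0, 1}" using assms by (auto simp: matroid_def)
  ultimately show ?thesis
    unfolding matroid_def polymatroid_def pm_restrict_def by simp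
qed

text \<open>Submodularity of the contraction is that of \<open>rk X\<close> at
  \<open>A \<union> B\<close> and \<open>A \<union> C\<close>, less \<open>rk X A\<close> twice on
  each side. A single element adds to \<open>A\<close> at most its own rank.\<close>

lemma matroid_contract:
  assumes X: "matroid X" and A: "A \<subseteq> ground X"
  shows "matroid (pm_contract X A)"
proof -
  have pm: "polymatroid X" using X by (simp add: matroid_def)
  have le: "rk X A \<le> rk X (A \<union> B)" if "B \<subseteq> ground X" for B
    using that A by (intro polymatroid_mono[OF pm]) auto
  have "rk X (A \<union> (B \<union> C)) - rk X A + (rk X (A \<union> B \<inter> C) - rk X A)
      \<le> rk X (A \<union> B) - rk X A + (rk X (A \<union> C) - rk X A)"
    if "B \<subseteq> ground X - A" "C \<subseteq> ground X - A" for B C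
  proof -
    have "A \<union> B \<union> (A \<union> C) = A \<union> (B \<union> C)" "(A \<union> B) \<inter> (A \<union> C) = A \<union> B \<inter> C" by auto
    then have "rk X (A \<union> (B \<union> C)) + rk X (A \<union> B \<inter> C) \<le> rk X (A \<union> B) + rk X (A \<union> C)"
      using polymatroid_submodular[OF pm, of "A \<union> B" "A \<union> C"] that A by auto
    moreover have "B \<union> C \<subseteq> ground X" "B \<inter> C \<subseteq> ground X" "B \<subseteq> ground X" "C \<subseteq> ground X"
      using that by auto
    ultimately show ?thesis using le[of "B \<union> C"] le[of "B \<inter> C"] le[of B] le[of C] by linarith
  qed
  moreover have "rk X (A \<union> B) - rk X A \<le> rk X (A \<union> C) - rk X A"
    if "B \<subseteq> C" "C \<subseteq> ground X - A" for B C
    using that A by (intro diff_le_mono polymatroid_mono[OF pm]) auto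
  moreover have "rk X (insert x A) - rk X A \<in> {0, 1}" if "x \<in> ground X - A" for x
  proof -
    have "rk X {x} \<in> {0, 1}" using X that by (auto simp: matroid_def)
    moreover have "rk X (insert x A) \<le> rk X A + rk X {x}"
      using polymatroid_submodular[OF pm, of A "{x}"] that A by auto
    ultimately show ?thesis by auto
  qed
  ultimately show ?thesis
    using pm by (auto simp: matroid_def polymatroid_def pm_contract_def)
qed

lemma pm_iso_refl: "pm_iso X X"
  unfolding pm_iso_def by (intro exI[of _ id]) auto

lemma pm_iso_matroid:
  assumes "pm_iso X Y" "matroid X" "polymatroid Y"
  shows "matroid Y"
proof -
  obtain f where f: "bij_betw f (ground X) (ground Y)" "\<And>A. A \<subseteq> ground X \<Longrightarrow> rk Y (f ` A) = rk X A"
    using assms(1) by (auto simp: pm_iso_def)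
  have "rk Y {y} \<in> {0, 1}" if y: "y \<in> ground Y" for y
  proof -
    obtain x where "x \<in> ground X" "y = f x" using f(1) y unfolding bij_betw_def by blast
    then show ?thesis using f(2)[of "{x}"] assms(2) by (auto simp: matroid_def)
  qed
  then show ?thesis using assms(3) by (simp add: matroid_def)
qed

text \<open>An isomorphism carries permutations to permutations with the same rank words. Thus the
  invariant descends to isomorphism classes.\<close>

lemma G_pm_iso:
  assumes "pm_iso X Y" "finite (ground X)"
  shows "G_pm X = G_pm Y"
proof -
  obtain f where f: "bij_betw f (ground X) (ground Y)" "\<And>A. A \<subseteq> ground X \<Longrightarrow> rk Y (f ` A) = rk X A"
    using assms(1) by (auto simp: pm_iso_def)
  have img: "f ` ground X = ground Y" and inj: "inj_on f (ground X)"
    using f(1) by (auto simp: bij_betw_def)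
  have perms: "permutations_of_set (ground Y) = map f ` permutations_of_set (ground X)"
    using permutations_of_set_image_inj[OF inj] img by simp
  have inj_map: "inj_on (map f) (permutations_of_set (ground X))"
    using inj by (intro inj_onI) (auto simp: permutations_of_set_def intro: map_inj_on)
  have "rank_word (rk X) {} xs = rank_word (rk Y) {} (map f xs)"
    if "xs \<in> permutations_of_set (ground X)" for xs
  proof -
    have "rank_word (rk Y) {} (map f xs) = rank_word (\<lambda>B. rk Y (f ` B)) {} xs"
      using rank_word_image[of "rk Y" f "{}" xs] by simp
    also have "\<dots> = rank_word (rk X) {} xs"
      by (rule rank_word_cong[of "ground X"]) (use f(2) that in \<open>auto simp: permutations_of_set_def\<close>)
    finally show ?thesis by simp
  qed
  moreover have "finite (ground Y)" using img assms(2) by (metis finite_imageI)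
  ultimately show ?thesis
    using assms(2) by (simp add: G_pm_conv_permutations perms sum.reindex[OF inj_map])
qed

lemma basis_Mat [simp]: "basis Mat = {iso_class X | X :: nat pmat. matroid X}"
  by (simp add: Mat_def)

lemma basis_QSym [simp]: "basis QSym = {\<alpha>. \<forall>i\<in>set \<alpha>. 0 < i}"
  by (simp add: QSym_def)

text \<open>\<open>pm_rep\<close> chooses arbitrarily, but \<open>X\<close> lies in its own class,
  so the class is nonempty and the chosen element is a copy of \<open>X\<close>.\<close>

lemma pm_rep_iso_class:
  fixes X :: "nat pmat"
  assumes "matroid X"
  shows "matroid (pm_rep (iso_class X))"
    "card (ground (pm_rep (iso_class X))) = card (ground X)"
    "G_pm (pm_rep (iso_class X)) = G_pm X"
proof -
  have pm: "polymatroid X" using assms by (simp add: matroid_def)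
  then have "X \<in> iso_class X" by (simp add: iso_class_def pm_iso_refl)
  then have "pm_rep (iso_class X) \<in> iso_class X" unfolding pm_rep_def by (rule someI)
  then have *: "polymatroid (pm_rep (iso_class X))" and iso: "pm_iso X (pm_rep (iso_class X))"
    by (auto simp: iso_class_def)
  show "matroid (pm_rep (iso_class X))" using pm_iso_matroid[OF iso assms *] .
  show "card (ground (pm_rep (iso_class X))) = card (ground X)"
    using iso by (auto simp: pm_iso_def dest: bij_betw_same_card)
  show "G_pm (pm_rep (iso_class X)) = G_pm X"
    using G_pm_iso[OF iso] pm by (simp add: polymatroid_def)
qed

section \<open>The coproduct of the invariant\<close>

lemma U_in_hspace [simp]: "U a \<in> hspace QSym"
  by (simp add: U_def)

lemma G_pm_in_hspace: "G_pm X \<in> hspace QSym"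
  unfolding G_pm_def by (rule hspace_sum) simp

text \<open>Cutting a permutation amounts to choosing the set \<open>A\<close> of its first letters
  and ordering \<open>A\<close> and its complement separately. The head is read in the restriction,
  which has the same rank function, and the tail in the contraction by \<open>A\<close>.\<close>

lemma hcomult_G_pm:
  assumes X: "polymatroid X"
  shows "hcomult QSym (G_pm X) =
    (\<Sum>A\<in>Pow (ground X). \<Sum>ys\<in>permutations_of_set A. \<Sum>zs\<in>permutations_of_set (ground X - A).
      bvec (map Suc (rank_word (rk X) {} ys), map Suc (rank_word (rk (pm_contract X A)) {} zs)))"
proof -
  let ?E = "ground X"
  have fin: "finite ?E" using X by (simp add: polymatroid_def)
  let ?w = "\<lambda>xs. map Suc (rank_word (rk X) {} xs)"
  let ?T = "SIGMA A:Pow ?E. permutations_of_set A \<times> permutations_of_set (?E - A)"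
  have lenp: "length xs = card ?E" if "xs \<in> permutations_of_set ?E" for xs
    using that by (auto simp: permutations_of_set_def distinct_card[symmetric])
  have "hcomult QSym (G_pm X) = (\<Sum>xs\<in>permutations_of_set ?E. hcomult QSym (bvec (?w xs)))"
    by (simp add: G_pm_conv_permutations fin hcomult_def lin_ext_sum U_def)
  also have "\<dots> = (\<Sum>xs\<in>permutations_of_set ?E. \<Sum>k\<le>card ?E. bvec (take k (?w xs), drop k (?w xs)))"
    by (intro sum.cong refl) (simp add: hcomult_QSym_bvec lenp)
  also have "\<dots> = (\<Sum>(xs, k)\<in>permutations_of_set ?E \<times> {..card ?E}. bvec (take k (?w xs), drop k (?w xs)))"
    by (simp add: sum.cartesian_product)
  also have "\<dots> = (\<Sum>(A, ys, zs)\<in>?T.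
      bvec (?w ys, map Suc (rank_word (rk (pm_contract X A)) {} zs)))"
  proof (rule sum.reindex_bij_witness[where j = "\<lambda>(xs, k). (set (take k xs), take k xs, drop k xs)"
        and i = "\<lambda>(A, ys, zs). (ys @ zs, length ys)"])
    fix a assume "a \<in> permutations_of_set ?E \<times> {..card ?E}"
    then obtain xs k where a: "a = (xs, k)" "xs \<in> permutations_of_set ?E" "k \<le> card ?E" by auto
    have xs: "set xs = ?E" "distinct xs" "length xs = card ?E"
      using a lenp by (auto simp: permutations_of_set_def)
    have dr: "set (drop k xs) = ?E - set (take k xs)"
    proof -
      have "set (take k xs) \<union> set (drop k xs) = ?E" "set (take k xs) \<inter> set (drop k xs) = {}"
        using xs(1,2) by (simp_all flip: set_append add: set_take_disj_set_drop_if_distinct)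
      then show ?thesis by auto
    qed
    show "(case case a of (xs, k) \<Rightarrow> (set (take k xs), take k xs, drop k xs) of (A, ys, zs) \<Rightarrow> (ys @ zs, length ys)) = a"
      using a xs by simp
    show "(case a of (xs, k) \<Rightarrow> (set (take k xs), take k xs, drop k xs)) \<in> ?T"
      using a xs dr by (auto simp: permutations_of_set_def dest: in_set_takeD)
    let ?A = "set (take k xs)"
    have sub: "?A \<subseteq> ?E" using xs by (auto dest: in_set_takeD)
    have "rank_word (rk X) {} xs = rank_word (rk X) {} (take k xs) @ rank_word (rk X) ?A (drop k xs)"
      using rank_word_append[of "rk X" "{}" "take k xs" "drop k xs"] by simp
    \<comment> \<open>The tail is read starting from \<open>?A\<close>; monotonicity of the rank
      turns it into a word of the contraction starting from the empty set.\<close>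
    moreover have "rank_word (rk (pm_contract X ?A)) {} (drop k xs) = rank_word (rk X) ?A (drop k xs)"
      using rank_word_contract[of "{}" "drop k xs" "rk X" ?A] dr sub
      by (auto simp: pm_contract_def intro!: polymatroid_mono[OF X])
    ultimately show "(case case a of (xs, k) \<Rightarrow> (set (take k xs), take k xs, drop k xs) of
       (A, ys, zs) \<Rightarrow> bvec (?w ys, map Suc (rank_word (rk (pm_contract X A)) {} zs))) =
      (case a of (xs, k) \<Rightarrow> bvec (take k (?w xs), drop k (?w xs)))"
      using a xs by simp
  next
    fix b assume "b \<in> ?T"
    then obtain A ys zs where b: "b = (A, ys, zs)" "A \<subseteq> ?E" "set ys = A" "distinct ys"
      "set zs = ?E - A" "distinct zs"
      by (auto simp: permutations_of_set_def)
    show "(case case b of (A, ys, zs) \<Rightarrow> (ys @ zs, length ys) of (xs, k) \<Rightarrow> (set (take k xs), take k xs, drop k xs)) = b"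
      using b by simp
    have "length ys \<le> card ?E" using b fin by (metis card_mono distinct_card)
    then show "(case b of (A, ys, zs) \<Rightarrow> (ys @ zs, length ys)) \<in> permutations_of_set ?E \<times> {..card ?E}"
      using b by (auto simp: permutations_of_set_def)
  qed
  also have "\<dots> = (\<Sum>A\<in>Pow ?E. \<Sum>(ys, zs)\<in>permutations_of_set A \<times> permutations_of_set (?E - A).
      bvec (?w ys, map Suc (rank_word (rk (pm_contract X A)) {} zs)))"
    using fin by (subst sum.Sigma) auto
  finally show ?thesis by (simp add: sum.cartesian_product)
qed


section \<open>Sums of loops and coloops, and the character \<open>gamma\<close>\<close>

definition loops :: "'a pmat \<Rightarrow> 'a set" where
  "loops X = {x \<in> ground X. rk X {x} = 0}"

text \<open>By submodularity a new element raises the rank by at most its own rank, which is 0 for a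
  loop and at most 1 otherwise.\<close>

lemma matroid_rank_Un_le:
  assumes X: "matroid X" and A: "A \<subseteq> ground X" and B: "B \<subseteq> ground X"
  shows "rk X (A \<union> B) \<le> rk X A + card (B - loops X)"
proof -
  have pm: "polymatroid X" using X by (simp add: matroid_def)
  have "finite B" using pm B by (metis finite_subset polymatroid_def)
  then show ?thesis using B
  proof (induction B rule: finite_induct)
    case (insert x B)
    have fin: "finite (B - loops X)" using insert by simp
    have "rk X ((A \<union> B) \<union> {x}) \<le> rk X (A \<union> B) + rk X {x}"
      using polymatroid_submodular[OF pm, of "A \<union> B" "{x}"] insert.prems A by auto
    moreover have "rk X {x} + card (B - loops X) \<le> card (insert x B - loops X)"
    proof (cases "x \<in> loops X")
      case True
      then show ?thesis by (simp add: loops_def)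
    next
      case False
      then have "rk X {x} \<le> 1" using X insert.prems by (auto simp: matroid_def loops_def)
      then show ?thesis using False fin insert.hyps by (simp add: insert_Diff_if)
    qed
    ultimately show ?case using insert by auto
  qed simp
qed

text \<open>As long as the rank stays 0, only loops are passed. From the first positive letter on, a
  sorted word has only positive letters, so the rank grows by at least the number of remaining
  elements, while it can grow by at most the number of non-loops among them.\<close>

lemma rank_eq_card_if_sorted_rank_word:
  assumes X: "matroid X"
    and "A \<union> set xs \<subseteq> ground X" "distinct xs" "rk X A = 0" "sorted (rank_word (rk X) A xs)"
  shows "rk X (A \<union> set xs) = card (set xs - loops X)"
  using assms(2-)
proof (induction xs arbitrary: A)
  case (Cons x xs)
  have pm: "polymatroid X" using X by (simp add: matroid_def)
  show ?case
  proof (cases "rk X (insert x A) = 0")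
    case True
    have "rk X {x} \<le> rk X (insert x A)" using Cons.prems by (intro polymatroid_mono[OF pm]) auto
    then have "x \<in> loops X" using True Cons.prems by (simp add: loops_def)
    then show ?thesis using Cons.IH[of "insert x A"] True Cons.prems by (simp add: insert_Diff_if)
  next
    case False
    let ?w = "rank_word (rk X) A (x # xs)"
    have "\<forall>i\<in>set ?w. 1 \<le> i" using False Cons.prems by auto
    then have "length ?w \<le> sum_list ?w"
      using sum_list_mono[of ?w "\<lambda>_. 1" "\<lambda>i. i"] by (simp add: sum_list_triv del: rank_word.simps)
    moreover have "rk X A + sum_list ?w = rk X (A \<union> set (x # xs))"
      by (rule sum_list_rank_word[of "ground X"]) (use Cons.prems polymatroid_mono[OF pm] in auto)
    moreover have "rk X (A \<union> set (x # xs)) \<le> rk X A + card (set (x # xs) - loops X)"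
      by (rule matroid_rank_Un_le[OF X]) (use Cons.prems in auto)
    moreover have "card (set (x # xs) - loops X) \<le> length (x # xs)"
      by (rule order_trans[OF card_mono card_length]) auto
    \<comment> \<open>Word length \<le> sum of letters \<le> number of non-loops \<le> word length,
      so equality holds throughout.\<close>
    ultimately show ?thesis using Cons.prems(3) by (simp only: length_rank_word)
  qed
qed simp

text \<open>If \<open>A\<close> fell short of its upper bound, the upper bound on what the elements
  outside \<open>A\<close> add could not make up for it.\<close>

lemma matroid_rank_eq_card:
  assumes X: "matroid X" and eq: "rk X (ground X) = card (ground X - loops X)"
    and A: "A \<subseteq> ground X"
  shows "rk X A = card (A - loops X)"
proof (rule antisym)
  have fin: "finite (ground X)" using X by (simp add: matroid_def polymatroid_def)
  show "rk X A \<le> card (A - loops X)"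
    using matroid_rank_Un_le[OF X, of "{}" A] X A by (simp add: matroid_def polymatroid_def)
  have "card (ground X - loops X) \<le> rk X A + card ((ground X - A) - loops X)"
    using matroid_rank_Un_le[OF X, of A "ground X - A"] A eq by (simp add: Un_absorb1)
  moreover have "card (ground X - loops X) = card (A - loops X) + card ((ground X - A) - loops X)"
    using A fin by (subst card_Un_disjoint[symmetric]) (auto intro: finite_subset arg_cong[of _ _ card])
  ultimately show "card (A - loops X) \<le> rk X A" by simp
qed

lemma rank_word_card_Diff:
  assumes "\<And>B. B \<subseteq> S \<Longrightarrow> r B = card (B - L)" "finite S" "A \<union> set xs \<subseteq> S" "distinct xs" "A \<inter> set xs = {}"
  shows "rank_word r A xs = map (\<lambda>x. if x \<in> L then 0 else 1) xs"
  using assms(3-)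
proof (induction xs arbitrary: A)
  case (Cons x xs)
  have "finite A" using Cons.prems assms(2) by (auto intro: finite_subset)
  then show ?case
    using Cons.prems Cons.IH[of "insert x A"] by (auto simp: assms(1) insert_Diff_if)
qed simp

lemma coloop_neq_loop: "coloop \<noteq> loop"
  by (auto simp: loop_def coloop_def fun_eq_iff intro: exI[of _ "{()}"])

text \<open>The map sends \<open>x\<close> to the only point of the summand with index
  \<open>h x\<close>. As \<open>h\<close> is injective, this summand contributes 1 exactly if it is
  a coloop and \<open>x\<close> lies in \<open>A\<close>.\<close>

lemma rk_pm_Sum_loops_coloops:
  assumes "inj_on h E" "finite E" "\<And>x. x \<in> E \<Longrightarrow> Y (h x) \<in> {loop, coloop}" "A \<subseteq> E"
  shows "rk (pm_Sum (h ` E) Y) ((\<lambda>x. (h x, ())) ` A) = card (A - {x. Y (h x) = loop})"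
proof -
  have "rk (pm_Sum (h ` E) Y) ((\<lambda>x. (h x, ())) ` A) =
      (\<Sum>x\<in>E. rk (Y (h x)) (Pair (h x) -` (\<lambda>x. (h x, ())) ` A))"
    using assms(1) by (simp add: pm_Sum_def sum.reindex)
  also have "\<dots> = (\<Sum>x\<in>E. if x \<in> A - {x. Y (h x) = loop} then 1 else 0)"
  proof (intro sum.cong refl)
    fix x assume x: "x \<in> E"
    have "Pair (h x) -` (\<lambda>x. (h x, ())) ` A = (if x \<in> A then {()} else {})"
      using assms(1,4) x by (auto simp: inj_on_def)
    then show "rk (Y (h x)) (Pair (h x) -` (\<lambda>x. (h x, ())) ` A) =
        (if x \<in> A - {x. Y (h x) = loop} then 1 else 0)"
      using assms(3)[OF x] coloop_neq_loop by (auto simp: loop_def coloop_def)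
  qed
  also have "\<dots> = card (A - {x. Y (h x) = loop})"
  proof -
    have "E \<inter> (A - {x. Y (h x) = loop}) = A - {x. Y (h x) = loop}" using assms(4) by auto
    then show ?thesis using assms(2) by (simp only: sum.If_cases Collect_mem_eq) simp
  qed
  finally show ?thesis .
qed

text \<open>This trades an index set, summands and an isomorphism for a formula for ranks, in which
  \<open>L\<close> collects the elements sent to loops.\<close>

lemma sum_of_loops_coloops_iff_rank:
  assumes fin: "finite (ground X)"
  shows "sum_of_loops_coloops X \<longleftrightarrow> (\<exists>L. \<forall>A\<subseteq>ground X. rk X A = card (A - L))"
proof
  assume "sum_of_loops_coloops X"
  then obtain I :: "nat set" and Y f where Y: "\<forall>i\<in>I. Y i \<in> {loop, coloop}"
    and f: "bij_betw f (ground X) (ground (pm_Sum I Y))"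
      "\<forall>A\<subseteq>ground X. rk (pm_Sum I Y) (f ` A) = rk X A"
    unfolding sum_of_loops_coloops_def pm_iso_def by blast
  \<comment> \<open>The summands live on the one-point type, so \<open>f\<close> carries no
    information beyond its index component.\<close>
  define h where "h = fst \<circ> f"
  have f_h: "f = (\<lambda>x. (h x, ()))" by (auto simp: h_def fun_eq_iff prod_eq_iff)
  have "ground (Y i) = {()}" if "i \<in> I" for i using Y that by (auto simp: loop_def coloop_def)
  then have gr: "ground (pm_Sum I Y) = I \<times> {()}" by (auto simp: pm_Sum_def)
  have inj: "inj_on h (ground X)" using f(1) by (auto simp: bij_betw_def f_h inj_on_def)
  have "f ` ground X = I \<times> {()}" using f(1) gr by (simp add: bij_betw_def)
  then have "fst ` f ` ground X = I" by force
  then have I: "I = h ` ground X" by (simp add: h_def image_comp)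
  have "rk X A = card (A - {x. Y (h x) = loop})" if "A \<subseteq> ground X" for A
    using f(2) that rk_pm_Sum_loops_coloops[OF inj fin, of Y A] Y by (auto simp: f_h I)
  then show "\<exists>L. \<forall>A\<subseteq>ground X. rk X A = card (A - L)" by blast
next
  assume "\<exists>L. \<forall>A\<subseteq>ground X. rk X A = card (A - L)"
  then obtain L where L: "\<And>A. A \<subseteq> ground X \<Longrightarrow> rk X A = card (A - L)" by blast
  \<comment> \<open>Summands are indexed by naturals, so the finite ground set is numbered
    first.\<close>
  obtain h :: "'a \<Rightarrow> nat" where inj: "inj_on h (ground X)"
    using finite_imp_inj_to_nat_seg[OF fin] by blast
  define Y where "Y i = (if i \<in> h ` (L \<inter> ground X) then loop else coloop)" for i
  have Y: "Y (h x) = loop \<longleftrightarrow> x \<in> L" if "x \<in> ground X" for x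
    using inj that coloop_neq_loop by (auto simp: Y_def inj_on_def)
  have "\<forall>i\<in>h ` ground X. Y i \<in> {loop, coloop}" by (simp add: Y_def)
  moreover have "pm_iso X (pm_Sum (h ` ground X) Y)"
    unfolding pm_iso_def
  proof (intro exI[of _ "\<lambda>x. (h x, ())"] conjI allI impI)
    have "ground (Y i) = {()}" for i by (simp add: Y_def loop_def coloop_def)
    then show "bij_betw (\<lambda>x. (h x, ())) (ground X) (ground (pm_Sum (h ` ground X) Y))"
      using inj by (auto simp: pm_Sum_def bij_betw_def inj_on_def)
    show "rk (pm_Sum (h ` ground X) Y) ((\<lambda>x. (h x, ())) ` A) = rk X A" if "A \<subseteq> ground X" for A
    proof -
      have "A - {x. Y (h x) = loop} = A - L" using Y that by auto
      then show ?thesis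
        using rk_pm_Sum_loops_coloops[OF inj fin, of Y A] that L by (simp add: Y_def)
    qed
  qed
  ultimately show "sum_of_loops_coloops X"
    unfolding sum_of_loops_coloops_def using fin by blast
qed

text \<open>Ranks of singletons force the \<open>L\<close> of the rank formula to agree with
  \<open>loops X\<close> on the ground set; conversely, \<open>matroid_rank_eq_card\<close> provides
  the formula.\<close>

lemma sum_of_loops_coloops_iff_loops:
  assumes X: "matroid X"
  shows "sum_of_loops_coloops X \<longleftrightarrow> rk X (ground X) = card (ground X - loops X)"
proof -
  have fin: "finite (ground X)" using X by (simp add: matroid_def polymatroid_def)
  have "rk X (ground X) = card (ground X - loops X)"
    if L: "\<forall>A\<subseteq>ground X. rk X A = card (A - L)" for L
  proof -
    have "rk X {x} = 0 \<longleftrightarrow> x \<in> L" if "x \<in> ground X" for x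
      using L that by (auto simp: insert_Diff_if)
    then have "ground X - loops X = ground X - L" by (auto simp: loops_def)
    then show ?thesis using L by simp
  qed
  then show ?thesis
    unfolding sum_of_loops_coloops_iff_rank[OF fin] using matroid_rank_eq_card[OF X] by blast
qed

text \<open>After an element failing \<open>P\<close>, which has the larger value \<open>b\<close>,
  sortedness forbids the smaller value \<open>a\<close>.\<close>

lemma sorted_two_valued_split:
  fixes a b :: "'b :: linorder"
  assumes "sorted (map (\<lambda>x. if P x then a else b) xs)" "a < b"
  shows "xs = filter P xs @ filter (\<lambda>x. \<not> P x) xs"
  using assms(1)
proof (induction xs)
  case (Cons x xs)
  show ?case
  proof (cases "P x")
    case False
    then have "\<not> P y" if "y \<in> set xs" for y
      using Cons.prems that assms(2) by (force split: if_splits)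
    then have "filter P xs = []" "filter (\<lambda>x. \<not> P x) xs = xs"
      by (auto simp: filter_empty_conv filter_id_conv)
    then show ?thesis using False by simp
  qed (use Cons in auto)
qed simp

definition gamma_coeff :: "nat list \<Rightarrow> rat" where
  "gamma_coeff \<alpha> = (if sorted \<alpha> then 1 / (\<Prod>a\<in>set \<alpha>. fact (count_list \<alpha> a)) else 0)"

text \<open>Absent letters contribute \<open>fact 0 = 1\<close>. This allows one index set for all
  words, even if some letter does not occur.\<close>

lemma gamma_coeff_superset:
  assumes "sorted \<alpha>" "finite S" "set \<alpha> \<subseteq> S"
  shows "gamma_coeff \<alpha> = 1 / (\<Prod>a\<in>S. fact (count_list \<alpha> a))"
proof -
  have "(\<Prod>a\<in>set \<alpha>. fact (count_list \<alpha> a)) = (\<Prod>a\<in>S. fact (count_list \<alpha> a) :: rat)"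
    by (rule prod.mono_neutral_left) (use assms in \<open>auto simp: count_list_0_iff\<close>)
  then show ?thesis using assms by (simp add: gamma_coeff_def)
qed

text \<open>The word is sorted exactly when all of \<open>L\<close> comes first. There are
  \<open>fact (card L) * fact (card (E - L))\<close> such permutations, each weighted by the
  reciprocal of this number.\<close>

lemma sum_gamma_coeff_permutations:
  assumes fin: "finite E" and L: "L \<subseteq> E"
  shows "(\<Sum>xs\<in>permutations_of_set E. gamma_coeff (map (\<lambda>x. if x \<in> L then 1 else 2) xs)) = 1"
proof -
  let ?w = "map (\<lambda>x. if x \<in> L then 1 else 2 :: nat)"
  let ?T = "permutations_of_set L \<times> permutations_of_set (E - L)"
  let ?c = "fact (card L) * fact (card (E - L)) :: rat"
  have w: "?w (ys @ zs) = replicate (card L) 1 @ replicate (card (E - L)) 2"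
    if "ys \<in> permutations_of_set L" "zs \<in> permutations_of_set (E - L)" for ys zs
  proof -
    have "?w ys = map (\<lambda>_. 1) ys" "?w zs = map (\<lambda>_. 2) zs"
      using that by (auto simp: permutations_of_set_def)
    moreover have "length ys = card L" "length zs = card (E - L)"
      using that by (auto simp: permutations_of_set_def distinct_card[symmetric])
    ultimately show ?thesis by (simp add: map_replicate_const)
  qed
  have g: "gamma_coeff (?w (ys @ zs)) = 1 / ?c"
    if "ys \<in> permutations_of_set L" "zs \<in> permutations_of_set (E - L)" for ys zs
  proof -
    have cl: "count_list (replicate n a) b = (if a = b then n else 0)" for n and a b :: nat
      by (induction n) auto
    show ?thesis
      unfolding w[OF that]
      by (subst gamma_coeff_superset[of _ "{1, 2}"])
         (auto simp: sorted_append cl)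
  qed
  have inj: "inj_on (\<lambda>(ys, zs). ys @ zs) ?T"
  proof (rule inj_onI, clarify)
    fix ys zs ys' zs'
    assume "ys \<in> permutations_of_set L" "ys' \<in> permutations_of_set L" and eq: "ys @ zs = ys' @ zs'"
    then have "length ys = length ys'"
      by (auto simp: permutations_of_set_def) (metis distinct_card)
    then show "ys = ys' \<and> zs = zs'" using eq by simp
  qed
  have sub: "(\<lambda>(ys, zs). ys @ zs) ` ?T \<subseteq> permutations_of_set E"
    using L by (auto simp: permutations_of_set_def)
  \<comment> \<open>A permutation with sorted word would be the concatenation of its filters by
    membership in \<open>L\<close>, hence lie in the image.\<close>
  have zero: "gamma_coeff (?w xs) = 0"
    if xs: "xs \<in> permutations_of_set E - (\<lambda>(ys, zs). ys @ zs) ` ?T" for xs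
  proof -
    let ?ys = "filter (\<lambda>x. x \<in> L) xs" and ?zs = "filter (\<lambda>x. x \<notin> L) xs"
    have "\<not> sorted (?w xs)"
    proof
      assume "sorted (?w xs)"
      then have "xs = ?ys @ ?zs" by (rule sorted_two_valued_split) simp
      moreover have "(?ys, ?zs) \<in> ?T" using xs L by (auto simp: permutations_of_set_def)
      ultimately have "xs \<in> (\<lambda>(ys, zs). ys @ zs) ` ?T" by (intro image_eqI[of _ _ "(?ys, ?zs)"]) simp_all
      then show False using xs by blast
    qed
    then show ?thesis by (simp add: gamma_coeff_def)
  qed
  have "(\<Sum>xs\<in>permutations_of_set E. gamma_coeff (?w xs)) =
      (\<Sum>xs\<in>(\<lambda>(ys, zs). ys @ zs) ` ?T. gamma_coeff (?w xs))"
    using sub zero by (intro sum.mono_neutral_right ballI finite_permutations_of_set)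
  also have "\<dots> = (\<Sum>(ys, zs)\<in>?T. gamma_coeff (?w (ys @ zs)))"
    unfolding sum.reindex[OF inj] o_def by (intro sum.cong refl) (simp only: case_prod_beta)
  also have "\<dots> = (\<Sum>(ys, zs)\<in>?T. 1 / ?c)"
    by (intro sum.cong refl) (simp only: case_prod_beta mem_Times_iff g)
  also have "\<dots> = 1"
    using fin finite_subset[OF L fin] by (simp add: case_prod_beta)
  finally show ?thesis .
qed

text \<open>For a sum of loops and coloops the sorted words come from the permutations listing the
  loops first, and their weights add up to 1. For any other matroid no word is sorted, since a
  sorted one would make the rank equal to the number of non-loops.\<close>

lemma gamma_G_pm:
  assumes X: "matroid X"
  shows "gamma (G_pm X) = (if sum_of_loops_coloops X then 1 else 0)"
proof -
  let ?E = "ground X"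
  let ?w = "rank_word (rk X) {}"
  have pm: "polymatroid X" and fin: "finite ?E" and r0: "rk X {} = 0"
    using X by (auto simp: matroid_def polymatroid_def)
  have gam: "gamma = lin_form gamma_coeff" by (simp add: gamma_def gamma_coeff_def[abs_def])
  have eq: "gamma (G_pm X) = (\<Sum>xs\<in>permutations_of_set ?E. gamma_coeff (map Suc (?w xs)))"
    by (simp add: gam G_pm_conv_permutations fin lin_form_sum U_def)
  show ?thesis
  proof (cases "sum_of_loops_coloops X")
    case True
    then have "rk X ?E = card (?E - loops X)" by (simp add: sum_of_loops_coloops_iff_loops[OF X])
    note rank = matroid_rank_eq_card[OF X this]
    \<comment> \<open>The shift in \<open>U\<close> turns the letters 0 of loops and 1 of other
      elements into 1 and 2.\<close>
    have "map Suc (?w xs) = map (\<lambda>x. if x \<in> loops X then 1 else 2) xs"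
      if "xs \<in> permutations_of_set ?E" for xs
      using rank_word_card_Diff[of ?E "rk X" "loops X" "{}" xs] rank fin that
      by (simp add: permutations_of_set_def)
    then have "gamma (G_pm X) =
        (\<Sum>xs\<in>permutations_of_set ?E. gamma_coeff (map (\<lambda>x. if x \<in> loops X then 1 else 2) xs))"
      by (simp add: eq)
    also have "\<dots> = 1" by (rule sum_gamma_coeff_permutations[OF fin]) (auto simp: loops_def)
    finally show ?thesis using True by simp
  next
    case False
    have "gamma_coeff (map Suc (?w xs)) = 0" if xs: "xs \<in> permutations_of_set ?E" for xs
    proof -
      have "\<not> sorted (?w xs)"
        using rank_eq_card_if_sorted_rank_word[OF X, of "{}" xs] r0 xs False
        by (auto simp: sum_of_loops_coloops_iff_loops[OF X] permutations_of_set_def)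
      then have "\<not> sorted (map Suc (?w xs))" by (simp add: sorted_map)
      then show ?thesis by (simp add: gamma_coeff_def)
    qed
    then show ?thesis using False by (simp add: eq)
  qed
qed

section \<open>Comparison of the two morphisms through their coproducts\<close>

text \<open>By additivity of \<theta>, the double sum over orderings of \<open>A\<close> and of its
  complement factors into a product of two coefficients.\<close>

lemma lookup_tensor_map_hcomult_G_pm:
  fixes X :: "'a pmat"
  assumes X: "polymatroid X"
    and sum: "\<And>(S :: 'a list set) g. (\<And>i. i \<in> S \<Longrightarrow> g i \<in> hspace QSym) \<Longrightarrow>
      \<theta> (\<Sum>i\<in>S. g i) = (\<Sum>i\<in>S. \<theta> (g i))"
  shows "Poly_Mapping.lookup (tensor_map \<theta> (hcomult QSym (G_pm X))) (u, v) =
    (\<Sum>A\<in>Pow (ground X). Poly_Mapping.lookup (\<theta> (G_pm (pm_restrict X A))) u *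
       Poly_Mapping.lookup (\<theta> (G_pm (pm_contract X A))) v)"
proof -
  have \<theta>G: "\<theta> (G_pm Y) = (\<Sum>xs\<in>permutations_of_set (ground Y). \<theta> (bvec (map Suc (rank_word (rk Y) {} xs))))"
    if "finite (ground Y)" for Y :: "'a pmat"
    unfolding G_pm_conv_permutations[OF that] by (subst sum) (simp_all add: U_def)
  have fin: "finite (ground X)" using X by (simp add: polymatroid_def)
  show ?thesis
    unfolding hcomult_G_pm[OF X] tensor_map_sum tensor_map_bvec lookup_sum lookup_tensor
  proof (intro sum.cong refl)
    fix A assume "A \<in> Pow (ground X)"
    then have "finite (ground (pm_restrict X A))" "finite (ground (pm_contract X A))"
      using fin by (auto simp: pm_restrict_def pm_contract_def intro: finite_subset)
    note eq = \<theta>G[OF this(1)] \<theta>G[OF this(2)]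
    show "(\<Sum>ys\<in>permutations_of_set A. \<Sum>zs\<in>permutations_of_set (ground X - A).
        Poly_Mapping.lookup (\<theta> (bvec (map Suc (rank_word (rk X) {} ys)))) u *
        Poly_Mapping.lookup (\<theta> (bvec (map Suc (rank_word (rk (pm_contract X A)) {} zs)))) v) =
      Poly_Mapping.lookup (\<theta> (G_pm (pm_restrict X A))) u *
      Poly_Mapping.lookup (\<theta> (G_pm (pm_contract X A))) v"
      unfolding eq lookup_sum sum_product by (simp add: pm_restrict_def pm_contract_def)
  qed
qed

lemma hcomult_Mat_bvec:
  "hcomult Mat (bvec c) = (\<Sum>A\<in>Pow (ground (pm_rep c)).
     bvec (iso_class (pm_restrict (pm_rep c) A), iso_class (pm_contract (pm_rep c) A)))"
  by (simp add: hcomult_def Mat_def PolyMat_def Let_def)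

lemma G_pm_empty: "ground X = {} \<Longrightarrow> G_pm X = bvec []"
  by (simp add: G_pm_conv_permutations U_def)

lemma iso_class_empty:
  fixes X :: "nat pmat"
  assumes "polymatroid X" "ground X = {}"
  shows "bvec (iso_class X) = hunit Mat"
proof -
  have "iso_class X = iso_class ({} :: nat set, \<lambda>A. 0)"
    using assms by (auto simp: iso_class_def pm_iso_def polymatroid_def)
  then show ?thesis by (simp add: Mat_def PolyMat_def)
qed

text \<open>Gradings enter only through \<open>deg\<close>, which asks for a common positive degree
  of the two images of each matroid on a nonempty set. One argument thus serves both choices of
  grading.\<close>

lemma Mat_morphism_unique:
  assumes \<theta>: "hopf_morphism QSym QSym \<theta>" and F: "hopf_morphism Mat QSym F"
    and zeta_\<theta>: "\<And>x. x \<in> hspace QSym \<Longrightarrow> zeta (\<theta> x) = gamma x"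
    and zeta_F: "\<And>x. x \<in> hspace Mat \<Longrightarrow> zeta (F x) = zeta_Mat x"
    and deg: "\<And>c. c \<in> basis Mat \<Longrightarrow> ground (pm_rep c) \<noteq> {} \<Longrightarrow>
      \<exists>d>0. \<theta> (G_pm (pm_rep c)) \<in> hcomponent QSym d \<and> F (bvec c) \<in> hcomponent QSym d"
    and x: "x \<in> hspace Mat"
  shows "\<theta> (G x) = F x"
proof -
  have \<theta>_lin: "\<And>x y. x \<in> hspace QSym \<Longrightarrow> y \<in> hspace QSym \<Longrightarrow> \<theta> (x + y) = \<theta> x + \<theta> y"
    "\<And>c x. x \<in> hspace QSym \<Longrightarrow> \<theta> (scale c x) = scale c (\<theta> x)"
    and F_lin: "\<And>x y. x \<in> hspace Mat \<Longrightarrow> y \<in> hspace Mat \<Longrightarrow> F (x + y) = F x + F y"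
    "\<And>c x. x \<in> hspace Mat \<Longrightarrow> F (scale c x) = scale c (F x)"
    and \<theta>_unit: "\<theta> (bvec []) = bvec []" and F_unit: "F (hunit Mat) = bvec []"
    and \<theta>_comult: "\<And>x. x \<in> hspace QSym \<Longrightarrow> hcomult QSym (\<theta> x) = tensor_map \<theta> (hcomult QSym x)"
    and F_comult: "\<And>x. x \<in> hspace Mat \<Longrightarrow> hcomult QSym (F x) = tensor_map F (hcomult Mat x)"
    using \<theta> F by (simp_all add: hopf_morphism_def QSym_def)
  have G_add: "G (y + z) = G y + G z" and G_scale: "G (scale a y) = scale a (G y)" for y z a
    by (simp_all add: G_def lin_ext_add lin_ext_scale)
  have G_space: "G y \<in> hspace QSym" for y
    unfolding G_def by (rule hspace_lin_ext) (rule G_pm_in_hspace)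
  have matroid_rep: "matroid (pm_rep c)" if "c \<in> basis Mat" for c
    using that pm_rep_iso_class(1) by auto
  \<comment> \<open>The class on the empty ground set is the unit, which both composites send to the
    empty word.\<close>
  have unit: "\<theta> (G_pm (pm_rep c)) = bvec []" "F (bvec c) = bvec []"
    if c: "c \<in> basis Mat" and "card (ground (pm_rep c)) = 0" for c
  proof -
    obtain X :: "nat pmat" where X: "matroid X" "c = iso_class X" using c by auto
    have fin: "finite (ground X)" "finite (ground (pm_rep c))"
      using X matroid_rep[OF c] by (auto simp: matroid_def polymatroid_def)
    then have "ground (pm_rep c) = {}" "ground X = {}"
      using that(2) pm_rep_iso_class(2)[OF X(1)] by (auto simp: X(2))
    then show "\<theta> (G_pm (pm_rep c)) = bvec []" "F (bvec c) = bvec []"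
      using X iso_class_empty[of X] by (auto simp: G_pm_empty \<theta>_unit F_unit matroid_def)
  qed
  have main: "\<theta> (G_pm (pm_rep c)) = F (bvec c)" if "c \<in> basis Mat" for c
    using that
  proof (induction "card (ground (pm_rep c))" arbitrary: c rule: less_induct)
    case less
    define X where "X = pm_rep c"
    have X: "matroid X" using matroid_rep[OF less.prems] by (simp add: X_def)
    then have pm: "polymatroid X" and fin: "finite (ground X)" by (auto simp: matroid_def polymatroid_def)
    show ?case
    proof (cases "card (ground X) = 0")
      case True
      then show ?thesis using unit[OF less.prems] by (simp add: X_def)
    next
      case False
      obtain d where "d > 0" and d: "\<theta> (G_pm X) \<in> hcomponent QSym d" "F (bvec c) \<in> hcomponent QSym d"
        using deg[OF less.prems] False unfolding X_def by (metis card.empty)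
      have c: "bvec c \<in> hspace Mat" using less.prems by (simp only: hspace_bvec_iff)
      \<comment> \<open>Coefficients at words with at least two letters are read off the
        coproducts.\<close>
      have long: "Poly_Mapping.lookup (\<theta> (G_pm X)) (u @ v) = Poly_Mapping.lookup (F (bvec c)) (u @ v)"
        if uv: "u \<noteq> []" "v \<noteq> []" for u v
      proof -
        have "Poly_Mapping.lookup (\<theta> (G_pm X)) (u @ v) =
            Poly_Mapping.lookup (tensor_map \<theta> (hcomult QSym (G_pm X))) (u, v)"
          by (simp add: \<theta>_comult[OF G_pm_in_hspace] flip: lookup_hcomult_QSym)
        also have "\<dots> = (\<Sum>A\<in>Pow (ground X). Poly_Mapping.lookup (\<theta> (G_pm (pm_restrict X A))) u *
            Poly_Mapping.lookup (\<theta> (G_pm (pm_contract X A))) v)"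
          by (rule lookup_tensor_map_hcomult_G_pm[OF pm linear_on_hspace_sum[where \<phi> = \<theta>, OF \<theta>_lin]])
        also have "\<dots> = (\<Sum>A\<in>Pow (ground X). Poly_Mapping.lookup (F (bvec (iso_class (pm_restrict X A)))) u *
            Poly_Mapping.lookup (F (bvec (iso_class (pm_contract X A)))) v)"
        proof (intro sum.cong refl)
          fix A assume "A \<in> Pow (ground X)"
          then have A: "A \<subseteq> ground X" by simp
          let ?R = "pm_restrict X A" and ?C = "pm_contract X A"
          let ?r = "iso_class ?R" and ?c = "iso_class ?C"
          note R = matroid_restrict[OF X A] and C = matroid_contract[OF X A]
          have r: "?r \<in> basis Mat" and c: "?c \<in> basis Mat"
            unfolding basis_Mat using R C by blast+
          have cr: "card (ground (pm_rep ?r)) = card A"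
            and cc: "card (ground (pm_rep ?c)) = card (ground X - A)"
            using pm_rep_iso_class(2)[OF R] pm_rep_iso_class(2)[OF C]
            by (simp_all add: pm_restrict_def pm_contract_def)
          have G: "G_pm ?R = G_pm (pm_rep ?r)" "G_pm ?C = G_pm (pm_rep ?c)"
            using pm_rep_iso_class(3)[OF R] pm_rep_iso_class(3)[OF C] by simp_all
          \<comment> \<open>If \<open>A\<close> is empty or everything, one of the minors is
            \<open>X\<close> itself, beyond the reach of the induction hypothesis. The other minor
            is then empty, and since \<open>u\<close> and \<open>v\<close> are nonempty its
            coefficient vanishes on both sides.\<close>
          consider "A = {}" | "A = ground X" | "A \<subset> ground X" "A \<noteq> {}" using A by blast
          then show "Poly_Mapping.lookup (\<theta> (G_pm ?R)) u * Poly_Mapping.lookup (\<theta> (G_pm ?C)) v =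
              Poly_Mapping.lookup (F (bvec ?r)) u * Poly_Mapping.lookup (F (bvec ?c)) v"
          proof cases
            case 1
            then have "card (ground (pm_rep ?r)) = 0" using cr by simp
            from unit[OF r this] show ?thesis using uv by (simp add: G(1) lookup_single when_def)
          next
            case 2
            then have "card (ground (pm_rep ?c)) = 0" using cc by simp
            from unit[OF c this] show ?thesis using uv by (simp add: G(2) lookup_single when_def)
          next
            case 3
            then have "card A < card (ground X)" "card (ground X - A) < card (ground X)"
              using fin by (auto intro!: psubset_card_mono)
            then have "\<theta> (G_pm (pm_rep ?r)) = F (bvec ?r)" "\<theta> (G_pm (pm_rep ?c)) = F (bvec ?c)"
              using less.hyps[OF _ r] less.hyps[OF _ c] cr cc by (simp_all add: X_def)
            then show ?thesis by (simp add: G)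
          qed
        qed
        also have "\<dots> = Poly_Mapping.lookup (tensor_map F (hcomult Mat (bvec c))) (u, v)"
          by (simp add: hcomult_Mat_bvec X_def tensor_map_sum lookup_sum)
        also have "\<dots> = Poly_Mapping.lookup (F (bvec c)) (u @ v)"
          by (simp add: F_comult[OF c, symmetric] lookup_hcomult_QSym)
        finally show ?thesis .
      qed
      define \<delta> where "\<delta> = \<theta> (G_pm X) - F (bvec c)"
      have lookup_\<delta>: "Poly_Mapping.lookup \<delta> w =
          Poly_Mapping.lookup (\<theta> (G_pm X)) w - Poly_Mapping.lookup (F (bvec c)) w" for w
        by (simp add: \<delta>_def lookup_minus)
      \<comment> \<open>By homogeneity only words of sum \<open>d\<close> matter, and those with two
        or more letters are settled by \<open>long\<close>. As \<open>d\<close> is positive, the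
        empty word has the wrong sum, which leaves \<open>[d]\<close>.\<close>
      have "\<delta> = Poly_Mapping.single [d] (Poly_Mapping.lookup \<delta> [d])"
      proof (rule poly_mapping_eqI)
        fix w
        have "Poly_Mapping.lookup \<delta> w = 0" if "w \<noteq> [d]"
        proof (cases "sum_list w = d")
          case True
          then obtain a v where w: "w = [a] @ v" using \<open>d > 0\<close> by (cases w) auto
          then have "v \<noteq> []" using that True by auto
          then show ?thesis using long[of "[a]" v] by (simp add: w lookup_\<delta>)
        next
          case False
          then have "w \<notin> Poly_Mapping.keys (\<theta> (G_pm X))" "w \<notin> Poly_Mapping.keys (F (bvec c))"
            using d by (auto simp: hcomponent_def QSym_def)
          then show ?thesis by (simp add: lookup_\<delta> in_keys_iff)
        qed
        then show "Poly_Mapping.lookup \<delta> w =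
            Poly_Mapping.lookup (Poly_Mapping.single [d] (Poly_Mapping.lookup \<delta> [d])) w"
          by (auto simp: lookup_single when_def)
      qed
      moreover have "zeta \<delta> = 0"
      proof -
        \<comment> \<open>This form reduces the claim to additivity of \<open>zeta\<close> and to
          the agreement of \<open>gamma\<close> after the invariant with
          \<open>zeta_Mat\<close>.\<close>
        have "zeta (\<theta> (G_pm X)) = zeta (\<delta> + F (bvec c))" by (simp add: \<delta>_def)
        then have "gamma (G_pm X) = zeta \<delta> + zeta_Mat (bvec c)"
          by (simp add: zeta_add zeta_\<theta>[OF G_pm_in_hspace] zeta_F[OF c])
        then show ?thesis by (simp add: gamma_G_pm[OF X] zeta_Mat_def flip: X_def)
      qed
      \<comment> \<open>The one remaining coefficient equals \<open>zeta \<delta>\<close>.\<close>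
      ultimately have "\<delta> = 0" by (metis zeta_single_singleton single_zero)
      then show ?thesis by (simp add: \<delta>_def X_def)
    qed
  qed
  have "\<theta> (G x) = lin_ext (\<lambda>c. \<theta> (G (bvec c))) x"
    by (rule linear_on_hspace_lin_ext[where H = Mat and \<phi> = "\<lambda>x. \<theta> (G x)"])
       (simp_all add: x G_add G_scale \<theta>_lin G_space)
  also have "\<dots> = lin_ext (\<lambda>c. F (bvec c)) x"
    unfolding lin_ext_def
  proof (intro sum.cong refl)
    fix c assume "c \<in> Poly_Mapping.keys x"
    then have "c \<in> basis Mat" using x by (auto simp only: hspace_def)
    then show "scale (Poly_Mapping.lookup x c) (\<theta> (G (bvec c))) = scale (Poly_Mapping.lookup x c) (F (bvec c))"
      by (simp only: G_def lin_ext_single scale_1 main)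
  qed
  also have "\<dots> = F x"
    by (rule linear_on_hspace_lin_ext[symmetric, OF F_lin x])
  finally show ?thesis .
qed

section \<open>The two gradings\<close>

lemma hcomponent_sum:
  "(\<And>i. i \<in> S \<Longrightarrow> g i \<in> hcomponent H d) \<Longrightarrow> (\<Sum>i\<in>S. g i) \<in> hcomponent H d"
proof (induction S rule: infinite_finite_induct)
  case (insert i S)
  then show ?case
    using Poly_Mapping.keys_add[of "g i" "sum g S"]
    by (auto simp: hcomponent_def intro!: hspace_add)
qed (auto simp: hcomponent_def)

lemma G_pm_in_hcomponent_length:
  assumes "finite (ground X)"
  shows "G_pm X \<in> hcomponent (QSym\<lparr>deg := length\<rparr>) (card (ground X))"
  unfolding G_pm_conv_permutations[OF assms]
  by (rule hcomponent_sum)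
     (auto simp: hcomponent_def hspace_def U_def QSym_def permutations_of_set_def distinct_card[symmetric])

text \<open>The 1 added to each letter contributes the size of the ground set, and the rank
  increments telescope to the total rank.\<close>

lemma G_pm_in_hcomponent_sum_list:
  assumes "polymatroid X"
  shows "G_pm X \<in> hcomponent QSym (card (ground X) + rk X (ground X))"
proof -
  have fin: "finite (ground X)" and "rk X {} = 0" using assms by (auto simp: polymatroid_def)
  have "sum_list (map Suc (rank_word (rk X) {} xs)) = card (ground X) + rk X (ground X)"
    if xs: "xs \<in> permutations_of_set (ground X)" for xs
  proof -
    have "rk X {} + sum_list (rank_word (rk X) {} xs) = rk X ({} \<union> set xs)"
      by (rule sum_list_rank_word[of "ground X"])
         (use xs polymatroid_mono[OF assms] in \<open>auto simp: permutations_of_set_def\<close>)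
    moreover have "length xs = card (ground X)" "set xs = ground X"
      using xs by (auto simp: permutations_of_set_def distinct_card[symmetric])
    moreover have "sum_list (map Suc ys) = length ys + sum_list ys" for ys
      by (induction ys) auto
    ultimately show ?thesis using \<open>rk X {} = 0\<close> by simp
  qed
  then show ?thesis
    unfolding G_pm_conv_permutations[OF fin]
    by (intro hcomponent_sum) (auto simp: hcomponent_def hspace_def U_def QSym_def)
qed

lemma bvec_in_hcomponent: "c \<in> basis H \<Longrightarrow> bvec c \<in> hcomponent H (deg H c)"
  by (simp add: hcomponent_def)

text \<open>Degrees do not occur in the bialgebra axioms, so regrading the source changes
  nothing.\<close>

lemma hopf_morphism_deg_update:
  "hopf_morphism (H'\<lparr>deg := f\<rparr>) H \<phi> = hopf_morphism H' H \<phi>"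
  by (simp add: hopf_morphism_def hspace_def hmult_def hcomult_def hcounit_def)

lemma hspace_deg_update [simp]: "hspace (H\<lparr>deg := f\<rparr>) = hspace H"
  by (simp add: hspace_def)

text \<open>The invariant does not respect size of matroids and sum of letters. The two conjuncts
  are two remedies: counting letters in the source of \<theta>, or adding the rank to the size of a
  matroid. The target keeps the sum of letters as its degree in both.\<close>

theorem theorem7p4:
  shows "(\<forall>\<theta> F. cha_morphism (QSym\<lparr>deg := length\<rparr>) gamma QSym zeta \<theta> \<longrightarrow>
            cha_morphism Mat zeta_Mat QSym zeta F \<longrightarrow>
            (\<forall>x\<in>hspace Mat. \<theta> (G x) = F x)) \<and>
         (\<forall>\<theta> F. cha_morphism QSym gamma QSym zeta \<theta> \<longrightarrow>
            cha_morphism (Mat\<lparr>deg := \<lambda>c. class_size c + class_rank c\<rparr>) zeta_Mat QSym zeta F \<longrightarrow>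
            (\<forall>x\<in>hspace Mat. \<theta> (G x) = F x))"
proof -
  have rep: "polymatroid (pm_rep c)" "finite (ground (pm_rep c))" if "c \<in> basis Mat" for c
    using that pm_rep_iso_class(1) by (auto simp: matroid_def polymatroid_def)
  show ?thesis
  proof (intro conjI allI impI ballI)
    fix \<theta> F x
    assume \<theta>: "cha_morphism (QSym\<lparr>deg := length\<rparr>) gamma QSym zeta \<theta>"
      and F: "cha_morphism Mat zeta_Mat QSym zeta F" and x: "x \<in> hspace Mat"
    show "\<theta> (G x) = F x"
    proof (rule Mat_morphism_unique[OF _ _ _ _ _ x])
      show "hopf_morphism QSym QSym \<theta>" "hopf_morphism Mat QSym F"
        "\<And>x. x \<in> hspace QSym \<Longrightarrow> zeta (\<theta> x) = gamma x"
        "\<And>x. x \<in> hspace Mat \<Longrightarrow> zeta (F x) = zeta_Mat x"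
        using \<theta> F by (auto simp: cha_morphism_def hopf_morphism_deg_update)
      fix c assume c: "c \<in> basis Mat" and ne: "ground (pm_rep c) \<noteq> {}"
      have "deg Mat c = card (ground (pm_rep c))" by (simp add: Mat_def PolyMat_def class_size_def)
      \<comment> \<open>As a graded map, \<theta> turns word length in its source into sum of
        letters in its target.\<close>
      then have "\<theta> (G_pm (pm_rep c)) \<in> hcomponent QSym (card (ground (pm_rep c)))"
        "F (bvec c) \<in> hcomponent QSym (card (ground (pm_rep c)))"
        using \<theta> F G_pm_in_hcomponent_length[OF rep(2)[OF c]] bvec_in_hcomponent[OF c]
        by (auto simp: cha_morphism_def)
      moreover have "card (ground (pm_rep c)) > 0" using ne rep(2)[OF c] by (simp add: card_gt_0_iff)
      ultimately show "\<exists>d>0. \<theta> (G_pm (pm_rep c)) \<in> hcomponent QSym d \<and> F (bvec c) \<in> hcomponent QSym d"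
        by blast
    qed
  next
    fix \<theta> F x
    assume \<theta>: "cha_morphism QSym gamma QSym zeta \<theta>"
      and F: "cha_morphism (Mat\<lparr>deg := \<lambda>c. class_size c + class_rank c\<rparr>) zeta_Mat QSym zeta F"
        (is "cha_morphism ?M _ _ _ _")
      and x: "x \<in> hspace Mat"
    show "\<theta> (G x) = F x"
    proof (rule Mat_morphism_unique[OF _ _ _ _ _ x])
      show "hopf_morphism QSym QSym \<theta>" "hopf_morphism Mat QSym F"
        "\<And>x. x \<in> hspace QSym \<Longrightarrow> zeta (\<theta> x) = gamma x"
        "\<And>x. x \<in> hspace Mat \<Longrightarrow> zeta (F x) = zeta_Mat x"
        using \<theta> F by (auto simp: cha_morphism_def hopf_morphism_deg_update)
      fix c assume c: "c \<in> basis Mat" and ne: "ground (pm_rep c) \<noteq> {}"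
      let ?d = "card (ground (pm_rep c)) + rk (pm_rep c) (ground (pm_rep c))"
      have "bvec c \<in> hcomponent ?M ?d"
        using c by (simp add: hcomponent_def hspace_def class_size_def class_rank_def)
      then have "F (bvec c) \<in> hcomponent QSym ?d" using F unfolding cha_morphism_def by blast
      moreover have "\<theta> (G_pm (pm_rep c)) \<in> hcomponent QSym ?d"
        using \<theta> G_pm_in_hcomponent_sum_list[OF rep(1)[OF c]] unfolding cha_morphism_def by blast
      moreover have "?d > 0" using ne rep(2)[OF c] by (simp add: card_gt_0_iff)
      ultimately show "\<exists>d>0. \<theta> (G_pm (pm_rep c)) \<in> hcomponent QSym d \<and> F (bvec c) \<in> hcomponent QSym d"
        by blast
    qed
  qed
qed

end
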